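(* Let $n,k$ be positive integers, $T$ a UCPT$(n)$-Schur multiplier and $S$ a UCPT$(k)$-Schur multiplier. Then $$d_{\mathrm{cb}}\big(T\otimes S,\mathrm{conv}(\mathrm{Aut}(M_{nk}(\mathbb{C})))\big)\geq \tfrac12\, d_{\mathrm{cb}}\big(T,\mathrm{conv}(\mathrm{Aut}(M_n(\mathbb{C})))\big).$$ In particular, if $T\notin\mathrm{conv}(\mathrm{Aut}(M_n(\mathbb{C})))$, then $T$ fails the asymptotic quantum Birkhoff property.
   Context: A UCPT$(n)$-map is a unital completely positive trace-preserving linear map on $M_n(\mathbb{C})$. A UCPT$(n)$-Schur multiplier is a UCPT$(n)$-map of the form $x=(x_{ij})\mapsto(b_{ij}x_{ij})$ for a fixed matrix $(b_{ij})$. $\mathrm{Aut}(M_m(\mathbb{C}))$ is the set of maps $x\mapsto u^*xu$ with $u$ unitary, $\mathrm{conv}$ denotes convex hull, $M_n(\mathbb{C})\otimes M_k(\mathbb{C})$ is identified with $M_{nk}(\mathbb{C})$, and $d_{\mathrm{cb}}(T,\mathcal{C})=\inf_{R\in\mathcal{C}}\|T-R\|_{\mathrm{cb}}$. A UCPT$(n)$-map $T$ satisfies the asymptotic quantum Birkhoff property if $\lim_{k\to\infty} d_{\mathrm{cb}}\big(T^{\otimes k},\mathrm{conv}(\mathrm{Aut}(M_{n^k}(\mathbb{C})))\big)=0$. *)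

theory Defs
  imports Complex_Main "Jordan_Normal_Form.Matrix"
begin

text \<open>Matrices in M_d(C) are complex matrices in carrier_mat d d.
  Linear maps on M_d(C) are functions complex mat to complex mat; only their
  values on carrier_mat d d matter.\<close>

definition ctrans :: "complex mat \<Rightarrow> complex mat" where
  "ctrans A = mat (dim_col A) (dim_row A) (\<lambda>(i,j). cnj (A $$ (j,i)))"

definition unitary_mat :: "nat \<Rightarrow> complex mat \<Rightarrow> bool" where
  "unitary_mat d U \<longleftrightarrow> U \<in> carrier_mat d d \<and> ctrans U * U = 1\<^sub>m d \<and> U * ctrans U = 1\<^sub>m d"

definition psd_mat :: "nat \<Rightarrow> complex mat \<Rightarrow> bool" where
  "psd_mat d A \<longleftrightarrow> A \<in> carrier_mat d d \<and>
     (\<forall>v \<in> carrier_vec d. let z = (\<Sum>i<d. cnj (v $ i) * (A *\<^sub>v v) $ i) in Im z = 0 \<and> Re z \<ge> 0)"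

definition mtrace :: "complex mat \<Rightarrow> complex" where
  "mtrace A = (\<Sum>i<dim_row A. A $$ (i,i))"

definition munit :: "nat \<Rightarrow> nat \<Rightarrow> nat \<Rightarrow> complex mat" where
  "munit d i j = mat d d (\<lambda>(a,b). if a = i \<and> b = j then 1 else 0)"

text \<open>Kronecker product, identifying M_n \<otimes> M_k with M_(nk) via (i,p) \<mapsto> i*k+p.\<close>
definition kron :: "complex mat \<Rightarrow> complex mat \<Rightarrow> complex mat" where
  "kron A B = mat (dim_row A * dim_row B) (dim_col A * dim_col B)
     (\<lambda>(r,c). A $$ (r div dim_row B, c div dim_col B) * B $$ (r mod dim_row B, c mod dim_col B))"

text \<open>Tensor product T \<otimes> S of maps on M_n and M_k, as a (linear) map on M_(nk):
  the linear map sending E_ij \<otimes> E_pq to T(E_ij) \<otimes> S(E_pq).\<close>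
definition tensor_map :: "nat \<Rightarrow> nat \<Rightarrow> (complex mat \<Rightarrow> complex mat) \<Rightarrow> (complex mat \<Rightarrow> complex mat)
    \<Rightarrow> complex mat \<Rightarrow> complex mat" where
  "tensor_map n k T S x = mat (n*k) (n*k) (\<lambda>(r,c).
     \<Sum>i<n. \<Sum>j<n. \<Sum>p<k. \<Sum>q<k. x $$ (i*k+p, j*k+q) * kron (T (munit n i j)) (S (munit k p q)) $$ (r,c))"

fun tensor_pow :: "nat \<Rightarrow> nat \<Rightarrow> (complex mat \<Rightarrow> complex mat) \<Rightarrow> complex mat \<Rightarrow> complex mat" where
  "tensor_pow n 0 T = (\<lambda>x. x)"
| "tensor_pow n (Suc k) T = tensor_map n (n^k) T (tensor_pow n k T)"

definition linear_on :: "nat \<Rightarrow> (complex mat \<Rightarrow> complex mat) \<Rightarrow> bool" where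
  "linear_on d T \<longleftrightarrow> (\<forall>x\<in>carrier_mat d d. T x \<in> carrier_mat d d) \<and>
     (\<forall>x\<in>carrier_mat d d. \<forall>y\<in>carrier_mat d d. \<forall>a b. T (a \<cdot>\<^sub>m x + b \<cdot>\<^sub>m y) = a \<cdot>\<^sub>m T x + b \<cdot>\<^sub>m T y)"

definition completely_positive :: "nat \<Rightarrow> (complex mat \<Rightarrow> complex mat) \<Rightarrow> bool" where
  "completely_positive d T \<longleftrightarrow>
     (\<forall>m. \<forall>X. psd_mat (m*d) X \<longrightarrow> psd_mat (m*d) (tensor_map m d (\<lambda>x. x) T X))"

definition UCPT :: "nat \<Rightarrow> (complex mat \<Rightarrow> complex mat) \<Rightarrow> bool" where
  "UCPT d T \<longleftrightarrow> linear_on d T \<and> T (1\<^sub>m d) = 1\<^sub>m d \<and> completely_positive d T \<and>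
     (\<forall>x\<in>carrier_mat d d. mtrace (T x) = mtrace x)"

definition UCPT_schur :: "nat \<Rightarrow> (complex mat \<Rightarrow> complex mat) \<Rightarrow> bool" where
  "UCPT_schur d T \<longleftrightarrow> UCPT d T \<and>
     (\<exists>b\<in>carrier_mat d d. \<forall>x\<in>carrier_mat d d. T x = mat d d (\<lambda>(i,j). b $$ (i,j) * x $$ (i,j)))"

definition vnorm :: "complex vec \<Rightarrow> real" where
  "vnorm v = sqrt (\<Sum>i<dim_vec v. (cmod (v $ i))\<^sup>2)"

definition opnorm :: "complex mat \<Rightarrow> real" where
  "opnorm A = Sup {vnorm (A *\<^sub>v v) | v. v \<in> carrier_vec (dim_col A) \<and> vnorm v \<le> 1}"

definition map_norm :: "nat \<Rightarrow> (complex mat \<Rightarrow> complex mat) \<Rightarrow> real" where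
  "map_norm d T = Sup {opnorm (T X) | X. X \<in> carrier_mat d d \<and> opnorm X \<le> 1}"

definition cb_norm :: "nat \<Rightarrow> (complex mat \<Rightarrow> complex mat) \<Rightarrow> real" where
  "cb_norm d T = Sup {map_norm (m*d) (tensor_map m d (\<lambda>x. x) T) | m. m \<ge> 1}"

definition conv_aut :: "nat \<Rightarrow> (complex mat \<Rightarrow> complex mat) set" where
  "conv_aut d = {R. \<exists>N (lam :: nat \<Rightarrow> real) U.
      (\<forall>l<N. lam l \<ge> 0 \<and> unitary_mat d (U l)) \<and> (\<Sum>l<N. lam l) = 1 \<and>
      R = (\<lambda>x. mat d d (\<lambda>ij. \<Sum>l<N. complex_of_real (lam l) * (ctrans (U l) * x * U l) $$ ij))}"

definition d_cb :: "nat \<Rightarrow> (complex mat \<Rightarrow> complex mat) \<Rightarrow> (complex mat \<Rightarrow> complex mat) set \<Rightarrow> real" where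
  "d_cb d T C = Inf {cb_norm d (\<lambda>x. T x - R x) | R. R \<in> C}"

definition in_conv_aut :: "nat \<Rightarrow> (complex mat \<Rightarrow> complex mat) \<Rightarrow> bool" where
  "in_conv_aut d T \<longleftrightarrow> (\<exists>R\<in>conv_aut d. \<forall>x\<in>carrier_mat d d. T x = R x)"

definition asymptotic_QBP :: "nat \<Rightarrow> (complex mat \<Rightarrow> complex mat) \<Rightarrow> bool" where
  "asymptotic_QBP n T \<longleftrightarrow> (\<lambda>k. d_cb (n^k) (tensor_pow n k T) (conv_aut (n^k))) \<longlonglongrightarrow> 0"

end

theory Submission
  imports Defs "HOL-Analysis.L2_Norm" "HOL-Analysis.Elementary_Metric_Spaces"
    "Jordan_Normal_Form.Determinant"
begin

text \<open>
  Let R be a mixture of automorphisms Ad(U) at cb-distance \<delta> from T \<otimes> S. As S fixes the (0,0) entry of the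
  matrix unit E_00, compressing by the isometry V : v \<mapsto> v \<otimes> e_0 turns T \<otimes> S into T and R into the mixture R_V
  of the maps x \<mapsto> A*xA (stars are adjoints) with the contractions A = V*UV, still at cb-distance at most \<delta> from T.
  By the singular value decomposition A = (W + W')/2 with unitaries W, W' = A \<plusminus> iB, so that A*xA is the mean of
  W*xW and W'*xW' minus B*xB. Hence R_V = R' - \<Phi> with R' a mixture of automorphisms of M_n and \<Phi> completely
  positive, and the cb-norm of \<Phi> is the norm of \<Phi>(1) = 1 - R_V(1) = (T - R_V)(1), which is at most \<delta>. So T is
  within 2\<delta> of R'.

  If T has the asymptotic quantum Birkhoff property, the estimate applied to T and its tensor powers makes the
  distance from T to conv(Aut) zero, and conv(Aut) is closed by Caratheodory's theorem and compactness of the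
  unitary group.
\<close>

section \<open>Matrix products, adjoints and linear combinations\<close>

lemma assoc_mult_mat_dim:
  fixes A B C :: "'a::semiring_0 mat"
  assumes "dim_col A = dim_row B" "dim_col B = dim_row C"
  shows "A * B * C = A * (B * C)"
  by (rule assoc_mult_mat) (use assms in \<open>auto intro!: carrier_matI\<close>)

lemma eq_mat_dimI:
  assumes "\<And>i j. i < r \<Longrightarrow> j < c \<Longrightarrow> A $$ (i, j) = B $$ (i, j)"
    and "dim_row A = r" "dim_row B = r" "dim_col A = c" "dim_col B = c"
  shows "A = B"
  using assms by (intro eq_matI) auto

lemma mult_mult_carrier_mat:
  "\<lbrakk>A \<in> carrier_mat r m; B \<in> carrier_mat m m'; C \<in> carrier_mat m' c\<rbrakk> \<Longrightarrow> A * B * C \<in> carrier_mat r c"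
  by (intro mult_carrier_mat)

lemma index_mult_mat_sum:
  assumes "A \<in> carrier_mat r m" "B \<in> carrier_mat m c" "i < r" "j < c"
  shows "(A * B) $$ (i, j) = (\<Sum>k<m. A $$ (i, k) * B $$ (k, j))"
  using assms by (auto simp: scalar_prod_def atLeast0LessThan intro!: sum.cong)

lemma index_mult_mult_mat_sum:
  fixes A B C :: "'a::comm_semiring_0 mat"
  assumes A: "A \<in> carrier_mat r m" and B: "B \<in> carrier_mat m m'" and C: "C \<in> carrier_mat m' c"
    and "i < r" "j < c"
  shows "(A * B * C) $$ (i, j) = (\<Sum>p<m. \<Sum>q<m'. A $$ (i, p) * B $$ (p, q) * C $$ (q, j))"
proof -
  have "(A * B * C) $$ (i, j) = (\<Sum>p<m. A $$ (i, p) * (\<Sum>q<m'. B $$ (p, q) * C $$ (q, j)))"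
    using assms index_mult_mat_sum[OF A mult_carrier_mat[OF B C], of i j]
    by (simp add: assoc_mult_mat[OF A B C] index_mult_mat_sum[OF B C] del: index_mult_mat)
  then show ?thesis by (simp add: sum_distrib_left mult.assoc)
qed

lemma one_smult_mat: "1 \<cdot>\<^sub>m A = (A :: 'a::monoid_mult mat)"
  by (rule eq_matI) auto

lemma mult_add_smult_mult_mat:
  fixes A B C D :: "'a::comm_ring_1 mat"
  assumes A: "A \<in> carrier_mat r m" and B: "B \<in> carrier_mat m m'" and C: "C \<in> carrier_mat m m'"
    and D: "D \<in> carrier_mat m' c"
  shows "A * (a \<cdot>\<^sub>m B + b \<cdot>\<^sub>m C) * D = a \<cdot>\<^sub>m (A * B * D) + b \<cdot>\<^sub>m (A * C * D)"
proof -
  have "A * (a \<cdot>\<^sub>m B + b \<cdot>\<^sub>m C) = a \<cdot>\<^sub>m (A * B) + b \<cdot>\<^sub>m (A * C)"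
    using A B C by (simp add: mult_add_distrib_mat[of A r m _ m'] mult_smult_distrib[of A r m _ m'])
  moreover have "A * B \<in> carrier_mat r m'" "A * C \<in> carrier_mat r m'" using A B C by auto
  ultimately show ?thesis
    using D by (simp add: add_mult_distrib_mat[of _ r m'] mult_smult_assoc_mat[of _ r m']
        del: assoc_mult_mat)
qed

lemma index_mult_mat_vec_sum:
  assumes "A \<in> carrier_mat r m" "v \<in> carrier_vec m" "i < r"
  shows "(A *\<^sub>v v) $ i = (\<Sum>j<m. A $$ (i, j) * v $ j)"
  using assms by (auto simp: scalar_prod_def atLeast0LessThan intro!: sum.cong)

lemma cscalar_prod_sum:
  fixes v u :: "complex vec"
  assumes "u \<in> carrier_vec d"
  shows "v \<bullet>c u = (\<Sum>i<d. v $ i * cnj (u $ i))"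
  using assms by (auto simp: scalar_prod_def atLeast0LessThan intro!: sum.cong)

lemma dim_ctrans [simp]: "dim_row (ctrans A) = dim_col A" "dim_col (ctrans A) = dim_row A"
  by (simp_all add: ctrans_def)

lemma ctrans_carrier [simp]: "ctrans A \<in> carrier_mat r c \<longleftrightarrow> A \<in> carrier_mat c r"
  unfolding carrier_mat_def by auto

lemma index_ctrans [simp]: "i < dim_col A \<Longrightarrow> j < dim_row A \<Longrightarrow> ctrans A $$ (i, j) = cnj (A $$ (j, i))"
  by (simp add: ctrans_def)

lemma ctrans_ctrans [simp]: "ctrans (ctrans A) = A"
  by (rule eq_matI) auto

lemma ctrans_one [simp]: "ctrans (1\<^sub>m n) = 1\<^sub>m n"
  by (rule eq_matI) auto

lemma ctrans_mult: "dim_col A = dim_row B \<Longrightarrow> ctrans (A * B) = ctrans B * ctrans A"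
  by (rule eq_matI) (auto simp: scalar_prod_def mult.commute intro!: sum.cong)

lemma cscalar_prod_mult_mat_vec:
  assumes A: "A \<in> carrier_mat r c" and v: "v \<in> carrier_vec c" and u: "u \<in> carrier_vec r"
  shows "(A *\<^sub>v v) \<bullet>c u = v \<bullet>c (ctrans A *\<^sub>v u)"
proof -
  have Au: "ctrans A *\<^sub>v u \<in> carrier_vec c" using A u by auto
  have "v \<bullet>c (ctrans A *\<^sub>v u) = (\<Sum>j<c. \<Sum>i<r. A $$ (i, j) * v $ j * cnj (u $ i))"
    unfolding cscalar_prod_sum[OF Au] using A u
    by (intro sum.cong refl)
      (simp add: index_mult_mat_vec_sum[of "ctrans A" c r] sum_distrib_left mult_ac
          del: index_mult_mat_vec)
  also have "\<dots> = (\<Sum>i<r. \<Sum>j<c. A $$ (i, j) * v $ j * cnj (u $ i))"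
    by (rule sum.swap)
  also have "\<dots> = (A *\<^sub>v v) \<bullet>c u"
    unfolding cscalar_prod_sum[OF u] using A v
    by (intro sum.cong refl)
      (simp add: index_mult_mat_vec_sum sum_distrib_right del: index_mult_mat_vec)
  finally show ?thesis by simp
qed

definition mat_lincomb ::
    "nat \<Rightarrow> 'l set \<Rightarrow> ('l \<Rightarrow> complex) \<Rightarrow> ('l \<Rightarrow> complex mat) \<Rightarrow> complex mat" where
  "mat_lincomb d L c F = mat d d (\<lambda>ij. \<Sum>l\<in>L. c l * F l $$ ij)"

lemma mat_lincomb_carrier [simp]: "mat_lincomb d L c F \<in> carrier_mat d d"
  by (simp add: mat_lincomb_def)

lemma dim_mat_lincomb [simp]: "dim_row (mat_lincomb d L c F) = d"
  "dim_col (mat_lincomb d L c F) = d"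
  by (simp_all add: mat_lincomb_def)

lemma index_mat_lincomb [simp]:
  "i < d \<Longrightarrow> j < d \<Longrightarrow> mat_lincomb d L c F $$ (i, j) = (\<Sum>l\<in>L. c l * F l $$ (i, j))"
  by (simp add: mat_lincomb_def)

lemma mat_lincomb_cong:
  assumes "\<And>l. l \<in> L \<Longrightarrow> c l = c' l" "\<And>l. l \<in> L \<Longrightarrow> F l = F' l"
  shows "mat_lincomb d L c F = mat_lincomb d L c' F'"
  using assms by (simp add: mat_lincomb_def)

lemma mult_mat_lincomb_mult:
  assumes A: "A \<in> carrier_mat e d" and C: "C \<in> carrier_mat d e"
    and F: "\<And>l. l \<in> L \<Longrightarrow> F l \<in> carrier_mat d d"
  shows "A * mat_lincomb d L c F * C = mat_lincomb e L c (\<lambda>l. A * F l * C)"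
proof (rule eq_mat_dimI)
  fix i j assume ij: "i < e" "j < e"
  have "(A * mat_lincomb d L c F * C) $$ (i, j)
      = (\<Sum>p<d. \<Sum>q<d. \<Sum>l\<in>L. c l * (A $$ (i, p) * F l $$ (p, q) * C $$ (q, j)))"
    unfolding index_mult_mult_mat_sum[OF A mat_lincomb_carrier C ij]
    by (intro sum.cong refl) (simp add: sum_distrib_left sum_distrib_right mult_ac)
  also have "\<dots> = (\<Sum>l\<in>L. \<Sum>p<d. \<Sum>q<d. c l * (A $$ (i, p) * F l $$ (p, q) * C $$ (q, j)))"
    by (simp only: sum.swap[of _ L])
  also have "\<dots> = mat_lincomb e L c (\<lambda>l. A * F l * C) $$ (i, j)"
    using ij by (simp add: index_mult_mult_mat_sum[OF A F C ij] sum_distrib_left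
        del: index_mult_mat)
  finally show "(A * mat_lincomb d L c F * C) $$ (i, j)
      = mat_lincomb e L c (\<lambda>l. A * F l * C) $$ (i, j)" .
qed (use A C in auto)

lemma cscalar_prod_mat_lincomb_mult_vec:
  assumes F: "\<And>l. l \<in> L \<Longrightarrow> F l \<in> carrier_mat d d" and v: "v \<in> carrier_vec d"
    and u: "u \<in> carrier_vec d"
  shows "(mat_lincomb d L c F *\<^sub>v v) \<bullet>c u = (\<Sum>l\<in>L. c l * ((F l *\<^sub>v v) \<bullet>c u))"
proof -
  have "(mat_lincomb d L c F *\<^sub>v v) \<bullet>c u
      = (\<Sum>i<d. \<Sum>j<d. \<Sum>l\<in>L. c l * (F l $$ (i, j) * v $ j * cnj (u $ i)))"
    unfolding cscalar_prod_sum[OF u]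
    by (intro sum.cong refl)
      (simp add: index_mult_mat_vec_sum[OF mat_lincomb_carrier v] sum_distrib_left sum_distrib_right
          mult_ac
        del: index_mult_mat_vec)
  also have "\<dots> = (\<Sum>l\<in>L. \<Sum>i<d. \<Sum>j<d. c l * (F l $$ (i, j) * v $ j * cnj (u $ i)))"
    by (simp only: sum.swap[of _ L])
  also have "\<dots> = (\<Sum>l\<in>L. c l * ((F l *\<^sub>v v) \<bullet>c u))"
    unfolding cscalar_prod_sum[OF u]
    by (intro sum.cong refl)
      (simp add: index_mult_mat_vec_sum[OF F v] sum_distrib_left sum_distrib_right mult_ac
        del: index_mult_mat_vec)
  finally show ?thesis .
qed

section \<open>Kronecker products\<close>

lemma sum_lessThan_mult:
  "(\<Sum>i<m*d. f i) = (\<Sum>a<m. \<Sum>r<d. f (a * d + r))" for f :: "nat \<Rightarrow> 'a::comm_monoid_add"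
proof -
  have "sum f {a*d..<a*d+d} = (\<Sum>r<d. f (a * d + r))" for a
    using sum.shift_bounds_nat_ivl[of f 0 "a*d" d] by (simp add: add.commute lessThan_atLeast0)
  then show ?thesis by (simp flip: sum.nat_group)
qed

lemma mult_add_less_mult:
  fixes a r m d :: nat
  assumes "a < m" "r < d"
  shows "a * d + r < m * d"
proof -
  have "a * d + r < Suc a * d" using assms by simp
  also have "\<dots> \<le> m * d" using assms by (intro mult_le_mono1) simp
  finally show ?thesis .
qed

lemma div_mod_less_mult:
  fixes i m d :: nat
  assumes "i < m * d"
  shows "i div d < m" "i mod d < d"
  using assms by (auto simp: less_mult_imp_div_less intro!: mod_less_divisor gr0I)

lemma dim_kron [simp]:
  "dim_row (kron A B) = dim_row A * dim_row B" "dim_col (kron A B) = dim_col A * dim_col B"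
  by (simp_all add: kron_def)

lemma kron_carrier [simp]:
  "A \<in> carrier_mat r c \<Longrightarrow> B \<in> carrier_mat r' c' \<Longrightarrow> kron A B \<in> carrier_mat (r * r') (c * c')"
  by auto

lemma index_kron:
  assumes "A \<in> carrier_mat r c" "B \<in> carrier_mat r' c'" "i < r * r'" "j < c * c'"
  shows "kron A B $$ (i, j) = A $$ (i div r', j div c') * B $$ (i mod r', j mod c')"
  using assms by (auto simp: kron_def)

lemma index_kron_mult_add:
  assumes "A \<in> carrier_mat r c" "B \<in> carrier_mat r' c'" "i < r" "j < c" "p < r'" "q < c'"
  shows "kron A B $$ (i * r' + p, j * c' + q) = A $$ (i, j) * B $$ (p, q)"
  using assms by (simp add: index_kron[of A r c B r' c'] mult_add_less_mult)

lemma kron_mult: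
  assumes A: "A \<in> carrier_mat r s" and C: "C \<in> carrier_mat s t"
    and B: "B \<in> carrier_mat r' s'" and D: "D \<in> carrier_mat s' t'"
  shows "kron A B * kron C D = kron (A * C) (B * D)"
proof (rule eq_mat_dimI)
  fix i j assume ij: "i < r * r'" "j < t * t'"
  note bounds = div_mod_less_mult[OF ij(1)] div_mod_less_mult[OF ij(2)]
  have "(kron A B * kron C D) $$ (i, j) = (\<Sum>k<s * s'. kron A B $$ (i, k) * kron C D $$ (k, j))"
    using assms ij by (intro index_mult_mat_sum) auto
  also have "\<dots> = (\<Sum>a<s. \<Sum>b<s'. (A $$ (i div r', a) * C $$ (a, j div t'))
        * (B $$ (i mod r', b) * D $$ (b, j mod t')))"
    unfolding sum_lessThan_mult using ij
    by (intro sum.cong refl) (simp add: index_kron[OF A B] index_kron[OF C D] mult_add_less_mult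
        mult_ac)
  also have "\<dots> = (A * C) $$ (i div r', j div t') * (B * D) $$ (i mod r', j mod t')"
    unfolding index_mult_mat_sum[OF A C bounds(1,3)] index_mult_mat_sum[OF B D bounds(2,4)]
      sum_product ..
  also have "\<dots> = kron (A * C) (B * D) $$ (i, j)"
    using assms ij by (simp add: index_kron[of _ r t _ r' t'] del: index_mult_mat(1))
  finally show "(kron A B * kron C D) $$ (i, j) = kron (A * C) (B * D) $$ (i, j)" .
qed (use assms in auto)

lemma ctrans_kron: "ctrans (kron A B) = kron (ctrans A) (ctrans B)"
proof (rule eq_mat_dimI)
  fix i j assume ij: "i < dim_col A * dim_col B" "j < dim_row A * dim_row B"
  then show "ctrans (kron A B) $$ (i, j) = kron (ctrans A) (ctrans B) $$ (i, j)"
    by (simp add: kron_def div_mod_less_mult)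
qed auto

lemma kron_one_mult_kron_mult:
  assumes A: "A \<in> carrier_mat e d" and B: "B \<in> carrier_mat d e"
    and x: "x \<in> carrier_mat m m" and y: "y \<in> carrier_mat d d"
  shows "kron (1\<^sub>m m) A * kron x y * kron (1\<^sub>m m) B = kron x (A * y * B)"
  using x by (simp add: kron_mult[OF one_carrier_mat x A y]
      kron_mult[OF x one_carrier_mat mult_carrier_mat[OF A y] B] del: assoc_mult_mat)

lemma kron_one: "kron (1\<^sub>m m) (1\<^sub>m d) = 1\<^sub>m (m * d)"
proof (rule eq_mat_dimI)
  fix i j assume ij: "i < m * d" "j < m * d"
  have "i = j \<longleftrightarrow> i div d = j div d \<and> i mod d = j mod d" by (metis div_mult_mod_eq)
  then show "kron (1\<^sub>m m) (1\<^sub>m d) $$ (i, j) = 1\<^sub>m (m * d) $$ (i, j)"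
    using ij by (simp add: kron_def div_mod_less_mult)
qed auto

lemma kron_one_1_left [simp]: "kron (1\<^sub>m (Suc 0)) A = A"
  by (rule eq_matI) (auto simp: kron_def)

lemma kron_one_1_right [simp]: "kron A (1\<^sub>m (Suc 0)) = A"
  by (rule eq_matI) (auto simp: kron_def)

lemma kron_mat_lincomb:
  assumes x: "x \<in> carrier_mat m m" and F: "\<And>l. l \<in> L \<Longrightarrow> F l \<in> carrier_mat d d"
  shows "kron x (mat_lincomb d L c F) = mat_lincomb (m * d) L c (\<lambda>l. kron x (F l))"
proof (rule eq_mat_dimI)
  fix i j assume ij: "i < m * d" "j < m * d"
  then show "kron x (mat_lincomb d L c F) $$ (i, j)
      = mat_lincomb (m * d) L c (\<lambda>l. kron x (F l)) $$ (i, j)"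
    using index_kron[OF x F ij] div_mod_less_mult[of i m d] div_mod_less_mult[of j m d]
    by (simp add: index_kron[OF x mat_lincomb_carrier ij] sum_distrib_left mult_ac)
qed (use x in auto)

lemma munit_carrier [simp]: "munit d i j \<in> carrier_mat d d"
  by (simp add: munit_def)

lemma dim_munit [simp]: "dim_row (munit d i j) = d" "dim_col (munit d i j) = d"
  by (simp_all add: munit_def)

lemma index_munit [simp]:
  "a < d \<Longrightarrow> b < d \<Longrightarrow> munit d i j $$ (a, b) = (if a = i \<and> b = j then 1 else 0)"
  by (simp add: munit_def)

lemma munit_mult_mult_munit:
  assumes x: "x \<in> carrier_mat d d" and "i < d" "j < d" "p < d" "q < d"
  shows "munit d i p * x * munit d q j = x $$ (p, q) \<cdot>\<^sub>m munit d i j"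
proof (rule eq_mat_dimI)
  fix a b assume ab: "a < d" "b < d"
  have "(munit d i p * x * munit d q j) $$ (a, b)
      = (\<Sum>k<d. \<Sum>l<d. if l = q then if k = p then if a = i \<and> b = j then x $$ (p, q) else 0 else 0
          else 0)"
    unfolding index_mult_mult_mat_sum[OF munit_carrier x munit_carrier ab]
    using ab by (intro sum.cong refl) auto
  then show "(munit d i p * x * munit d q j) $$ (a, b) = (x $$ (p, q) \<cdot>\<^sub>m munit d i j) $$ (a, b)"
    using assms ab by simp
qed auto

lemma munit_eq_kron:
  assumes "i < m * d" "j < m * d"
  shows "munit (m * d) i j = kron (munit m (i div d) (j div d)) (munit d (i mod d) (j mod d))"
proof (rule eq_mat_dimI)
  fix a b assume ab: "a < m * d" "b < m * d"
  have "a = i \<and> b = j \<longleftrightarrow> (a div d = i div d \<and> b div d = j div d)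
      \<and> (a mod d = i mod d \<and> b mod d = j mod d)"
    by (metis div_mult_mod_eq)
  then show "munit (m * d) i j $$ (a, b)
      = kron (munit m (i div d) (j div d)) (munit d (i mod d) (j mod d)) $$ (a, b)"
    using ab by (simp add: index_kron[OF munit_carrier munit_carrier ab] div_mod_less_mult)
qed auto

section \<open>Linear maps and their tensor products\<close>

lemma linear_on_carrier: "linear_on d T \<Longrightarrow> x \<in> carrier_mat d d \<Longrightarrow> T x \<in> carrier_mat d d"
  by (simp add: linear_on_def)

lemma linear_on_add_smult:
  "\<lbrakk>linear_on d T; x \<in> carrier_mat d d; y \<in> carrier_mat d d\<rbrakk> \<Longrightarrow> T (a \<cdot>\<^sub>m x + b \<cdot>\<^sub>m y)
      = a \<cdot>\<^sub>m T x + b \<cdot>\<^sub>m T y"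
  by (simp add: linear_on_def)

lemma linear_on_zero:
  assumes "linear_on d T"
  shows "T (0\<^sub>m d d) = 0\<^sub>m d d"
proof -
  have "T (0 \<cdot>\<^sub>m 0\<^sub>m d d + 0 \<cdot>\<^sub>m 0\<^sub>m d d) = 0 \<cdot>\<^sub>m T (0\<^sub>m d d) + 0 \<cdot>\<^sub>m T (0\<^sub>m d d)"
    by (rule linear_on_add_smult[OF assms]) auto
  then show ?thesis using linear_on_carrier[OF assms, of "0\<^sub>m d d"] by (auto simp: mat_eq_iff)
qed

lemma mat_lincomb_insert:
  assumes "finite L" "l \<notin> L" "F l \<in> carrier_mat d d"
  shows "mat_lincomb d (insert l L) c F = c l \<cdot>\<^sub>m F l + 1 \<cdot>\<^sub>m mat_lincomb d L c F"
  by (rule eq_matI) (use assms in auto)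

lemma linear_on_apply_mat_lincomb:
  assumes T: "linear_on d T" and L: "finite L" and F: "\<And>l. l \<in> L \<Longrightarrow> F l \<in> carrier_mat d d"
  shows "T (mat_lincomb d L c F) = mat_lincomb d L c (\<lambda>l. T (F l))"
  using L F
proof (induction L rule: finite_induct)
  case empty
  have "mat_lincomb d {} c G = 0\<^sub>m d d" for G by (rule eq_matI) auto
  then show ?case by (simp add: linear_on_zero[OF T])
next
  case (insert l L)
  then show ?case
    by (simp add: mat_lincomb_insert linear_on_add_smult[OF T] linear_on_carrier[OF T])
qed

lemma mat_eq_lincomb_munit:
  assumes "x \<in> carrier_mat d d"
  shows "x = mat_lincomb d ({..<d} \<times> {..<d}) (\<lambda>pq. x $$ pq) (\<lambda>(p, q). munit d p q)"
proof (rule eq_mat_dimI)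
  fix i j assume ij: "i < d" "j < d"
  have "(\<Sum>pq\<in>{..<d} \<times> {..<d}. x $$ pq * (case pq of (p, q) \<Rightarrow> munit d p q) $$ (i, j))
      = (\<Sum>pq\<in>{..<d} \<times> {..<d}. if pq = (i, j) then x $$ (i, j) else 0)"
    using ij by (intro sum.cong refl) (auto split: if_splits)
  then show "x $$ (i, j)
      = mat_lincomb d ({..<d} \<times> {..<d}) (\<lambda>pq. x $$ pq) (\<lambda>(p, q). munit d p q) $$ (i, j)"
    using ij by simp
qed (use assms in auto)

lemma linear_on_expand:
  assumes T: "linear_on d T" and x: "x \<in> carrier_mat d d"
  shows "T x = mat_lincomb d ({..<d} \<times> {..<d}) (\<lambda>pq. x $$ pq) (\<lambda>(p, q). T (munit d p q))"
  using linear_on_apply_mat_lincomb[OF T, of "{..<d} \<times> {..<d}" "\<lambda>(p, q). munit d p q"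
      "\<lambda>pq. x $$ pq"]
  by (simp add: case_prod_unfold flip: mat_eq_lincomb_munit[OF x, unfolded case_prod_unfold])

lemma linear_on_index:
  assumes "linear_on d T" "x \<in> carrier_mat d d" "r < d" "s < d"
  shows "T x $$ (r, s) = (\<Sum>p<d. \<Sum>q<d. x $$ (p, q) * T (munit d p q) $$ (r, s))"
  using assms by (simp add: linear_on_expand[OF assms(1,2)] sum.cartesian_product case_prod_unfold)

lemma linear_on_eqI:
  assumes T: "linear_on d T" and S: "linear_on d S"
    and agree: "\<And>i j. i < d \<Longrightarrow> j < d \<Longrightarrow> T (munit d i j) = S (munit d i j)" and x: "x \<in> carrier_mat d d"
  shows "T x = S x"
  unfolding linear_on_expand[OF T x] linear_on_expand[OF S x]
  using agree by (intro mat_lincomb_cong) auto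

lemma linear_on_tensor_eqI:
  assumes T: "linear_on (m * d) T" and S: "linear_on (m * d) S"
    and agree: "\<And>x y. x \<in> carrier_mat m m \<Longrightarrow> y \<in> carrier_mat d d \<Longrightarrow> T (kron x y) = S (kron x y)"
    and z: "z \<in> carrier_mat (m * d) (m * d)"
  shows "T z = S z"
  by (rule linear_on_eqI[OF T S _ z]) (simp add: munit_eq_kron agree)

lemma linear_on_diff:
  assumes T: "linear_on d T" and S: "linear_on d S"
  shows "linear_on d (\<lambda>x. T x - S x)"
  unfolding linear_on_def
proof (intro conjI ballI allI)
  fix x y :: "complex mat" and a b assume xy: "x \<in> carrier_mat d d" "y \<in> carrier_mat d d"
  note carrier = xy[THEN linear_on_carrier[OF T]] xy[THEN linear_on_carrier[OF S]]
  show "T x - S x \<in> carrier_mat d d" using carrier by auto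
  show "T (a \<cdot>\<^sub>m x + b \<cdot>\<^sub>m y) - S (a \<cdot>\<^sub>m x + b \<cdot>\<^sub>m y) = a \<cdot>\<^sub>m (T x - S x) + b \<cdot>\<^sub>m (T y - S y)"
    unfolding linear_on_add_smult[OF T xy] linear_on_add_smult[OF S xy]
    by (rule eq_matI) (use carrier in \<open>auto simp: algebra_simps\<close>)
qed

lemma linear_on_mult_mult:
  assumes A: "A \<in> carrier_mat d d" and B: "B \<in> carrier_mat d d"
  shows "linear_on d (\<lambda>x. A * x * B)"
  using assms by (auto simp: linear_on_def mult_add_smult_mult_mat[OF A _ _ B]
      simp del: assoc_mult_mat)

lemma linear_on_conjugation:
  assumes T: "linear_on d T" and V: "V \<in> carrier_mat d e"
  shows "linear_on e (\<lambda>x. ctrans V * T (V * x * ctrans V) * V)"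
  unfolding linear_on_def
proof (intro conjI ballI allI)
  fix x y :: "complex mat" and a b assume xy: "x \<in> carrier_mat e e" "y \<in> carrier_mat e e"
  have Vc: "ctrans V \<in> carrier_mat e d" using V by simp
  have VxV: "V * z * ctrans V \<in> carrier_mat d d" if "z \<in> carrier_mat e e" for z using V that by auto
  note Tc = linear_on_carrier[OF T VxV]
  show "ctrans V * T (V * x * ctrans V) * V \<in> carrier_mat e e"
    using V Tc[OF xy(1)] by auto
  show "ctrans V * T (V * (a \<cdot>\<^sub>m x + b \<cdot>\<^sub>m y) * ctrans V) * V
      = a \<cdot>\<^sub>m (ctrans V * T (V * x * ctrans V) * V) + b \<cdot>\<^sub>m (ctrans V * T (V * y * ctrans V) * V)"
    unfolding mult_add_smult_mult_mat[OF V xy Vc]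
      linear_on_add_smult[OF T VxV[OF xy(1)] VxV[OF xy(2)]]
      mult_add_smult_mult_mat[OF Vc Tc[OF xy(1)] Tc[OF xy(2)] V] ..
qed

lemma linear_on_mat_lincomb:
  assumes T: "\<And>l. l \<in> L \<Longrightarrow> linear_on d (T l)"
  shows "linear_on d (\<lambda>x. mat_lincomb d L c (\<lambda>l. T l x))"
  unfolding linear_on_def
proof (intro conjI ballI allI)
  fix x y :: "complex mat" and a b assume xy: "x \<in> carrier_mat d d" "y \<in> carrier_mat d d"
  show "mat_lincomb d L c (\<lambda>l. T l (a \<cdot>\<^sub>m x + b \<cdot>\<^sub>m y))
      = a \<cdot>\<^sub>m mat_lincomb d L c (\<lambda>l. T l x) + b \<cdot>\<^sub>m mat_lincomb d L c (\<lambda>l. T l y)"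
    (is "?lhs = ?rhs")
  proof (rule eq_mat_dimI)
    fix i j assume ij: "i < d" "j < d"
    have "T l (a \<cdot>\<^sub>m x + b \<cdot>\<^sub>m y) $$ (i, j) = a * T l x $$ (i, j) + b * T l y $$ (i, j)" if "l \<in> L"
      for l
      using linear_on_add_smult[OF T[OF that] xy, of a b] ij
        xy[THEN linear_on_carrier[OF T[OF that]]] by auto
    then show "?lhs $$ (i, j) = ?rhs $$ (i, j)"
      using ij by (simp add: algebra_simps sum.distrib sum_distrib_left)
  qed auto
qed simp

abbreviation amplification ::
    "nat \<Rightarrow> nat \<Rightarrow> (complex mat \<Rightarrow> complex mat) \<Rightarrow> complex mat \<Rightarrow> complex mat" where
  "amplification m d T \<equiv> tensor_map m d (\<lambda>x. x) T"

lemma linear_on_tensor_map: "linear_on (n * k) (tensor_map n k T S)"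
  unfolding linear_on_def
proof (intro conjI ballI allI)
  fix x y :: "complex mat" and a b
  assume xy: "x \<in> carrier_mat (n * k) (n * k)" "y \<in> carrier_mat (n * k) (n * k)"
  show "tensor_map n k T S x \<in> carrier_mat (n * k) (n * k)" by (simp add: tensor_map_def)
  have "(a \<cdot>\<^sub>m x + b \<cdot>\<^sub>m y) $$ (i * k + p, j * k + q)
      = a * x $$ (i * k + p, j * k + q) + b * y $$ (i * k + p, j * k + q)"
    if "i < n" "j < n" "p < k" "q < k" for i j p q
    using xy mult_add_less_mult[OF that(1,3)] mult_add_less_mult[OF that(2,4)] by auto
  then show "tensor_map n k T S (a \<cdot>\<^sub>m x + b \<cdot>\<^sub>m y)
      = a \<cdot>\<^sub>m tensor_map n k T S x + b \<cdot>\<^sub>m tensor_map n k T S y"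
    by (intro eq_matI) (simp_all add: tensor_map_def distrib_right sum.distrib sum_distrib_left
        mult.assoc)
qed

lemmas tensor_map_carrier = linear_on_carrier[OF linear_on_tensor_map]

lemma linear_on_id: "linear_on d (\<lambda>x. x)"
  by (simp add: linear_on_def)

lemma tensor_map_kron:
  assumes T: "linear_on n T" and S: "linear_on k S"
    and x: "x \<in> carrier_mat n n" and y: "y \<in> carrier_mat k k"
  shows "tensor_map n k T S (kron x y) = kron (T x) (S y)"
proof (rule eq_mat_dimI)
  note Tx = linear_on_carrier[OF T x] and Sy = linear_on_carrier[OF S y]
  fix r s assume rs: "r < n * k" "s < n * k"
  note bounds = div_mod_less_mult[OF rs(1)] div_mod_less_mult[OF rs(2)]
  let ?t = "\<lambda>i j. x $$ (i, j) * T (munit n i j) $$ (r div k, s div k)"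
  let ?s = "\<lambda>p q. y $$ (p, q) * S (munit k p q) $$ (r mod k, s mod k)"
  have "tensor_map n k T S (kron x y) $$ (r, s) = (\<Sum>i<n. \<Sum>j<n. \<Sum>p<k. \<Sum>q<k. ?t i j * ?s p q)"
    unfolding tensor_map_def using rs
    by (auto simp: index_kron_mult_add[OF x y]
        index_kron[OF linear_on_carrier[OF T] linear_on_carrier[OF S]]
        mult_ac intro!: sum.cong)
  also have "\<dots> = (\<Sum>i<n. \<Sum>j<n. ?t i j) * (\<Sum>p<k. \<Sum>q<k. ?s p q)"
    unfolding sum_distrib_right unfolding sum_distrib_left ..
  also have "\<dots> = kron (T x) (S y) $$ (r, s)"
    unfolding index_kron[OF Tx Sy rs] linear_on_index[OF T x bounds(1,3)]
      linear_on_index[OF S y bounds(2,4)] ..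
  finally show "tensor_map n k T S (kron x y) $$ (r, s) = kron (T x) (S y) $$ (r, s)" .
qed (use linear_on_carrier[OF T x] linear_on_carrier[OF S y] in \<open>auto simp: tensor_map_def\<close>)

lemma amplification_1:
  assumes "linear_on d T" "x \<in> carrier_mat d d"
  shows "amplification 1 d T x = T x"
  using tensor_map_kron[OF linear_on_id assms(1) one_carrier_mat assms(2), of 1] by simp

lemma amplification_conjugation:
  assumes T: "linear_on d T" and V: "V \<in> carrier_mat d e" and z: "z \<in> carrier_mat (m * e) (m * e)"
  shows "amplification m e (\<lambda>x. ctrans V * T (V * x * ctrans V) * V) z
    = ctrans (kron (1\<^sub>m m) V) * amplification m d T (kron (1\<^sub>m m) V * z * ctrans (kron (1\<^sub>m m) V)) *
      kron (1\<^sub>m m) V"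
proof (rule linear_on_tensor_eqI[OF _ _ _ z])
  have W: "kron (1\<^sub>m m) V \<in> carrier_mat (m * d) (m * e)" using V by simp
  then show "linear_on (m * e) (\<lambda>z. ctrans (kron (1\<^sub>m m) V) *
      amplification m d T (kron (1\<^sub>m m) V * z * ctrans (kron (1\<^sub>m m) V)) * kron (1\<^sub>m m) V)"
    by (rule linear_on_conjugation[OF linear_on_tensor_map])
  fix x y :: "complex mat" assume x: "x \<in> carrier_mat m m" and y: "y \<in> carrier_mat e e"
  have Vc: "ctrans V \<in> carrier_mat e d" and VyV: "V * y * ctrans V \<in> carrier_mat d d"
    using V y by auto
  have "kron (1\<^sub>m m) V * kron x y * ctrans (kron (1\<^sub>m m) V) = kron x (V * y * ctrans V)"
    unfolding ctrans_kron ctrans_one by (rule kron_one_mult_kron_mult[OF V Vc x y])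
  moreover have "ctrans (kron (1\<^sub>m m) V) * kron x (T (V * y * ctrans V)) * kron (1\<^sub>m m) V
      = kron x (ctrans V * T (V * y * ctrans V) * V)"
    unfolding ctrans_kron ctrans_one
    by (rule kron_one_mult_kron_mult[OF Vc V x linear_on_carrier[OF T VyV]])
  ultimately show "amplification m e (\<lambda>x. ctrans V * T (V * x * ctrans V) * V) (kron x y)
      = ctrans (kron (1\<^sub>m m) V) * amplification m d T
        (kron (1\<^sub>m m) V * kron x y * ctrans (kron (1\<^sub>m m) V)) * kron (1\<^sub>m m) V"
    by (simp only: tensor_map_kron[OF linear_on_id linear_on_conjugation[OF T V] x y]
        tensor_map_kron[OF linear_on_id T x VyV])
qed (rule linear_on_tensor_map)

section \<open>Vector and operator norms\<close>

lemma vnorm_eq_L2_set: "vnorm v = L2_set (\<lambda>i. cmod (v $ i)) {..<dim_vec v}"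
  by (simp add: vnorm_def L2_set_def)

lemma vnorm_nonneg [simp]: "0 \<le> vnorm v"
  by (simp add: vnorm_eq_L2_set)

lemma vnorm_power2: "(vnorm v)\<^sup>2 = (\<Sum>i<dim_vec v. (cmod (v $ i))\<^sup>2)"
  by (simp add: vnorm_def sum_nonneg)

lemma cscalar_prod_self: "v \<bullet>c v = complex_of_real ((vnorm v)\<^sup>2)"
  unfolding vnorm_power2 of_real_sum complex_norm_square
  by (rule cscalar_prod_sum) (rule carrier_vecI[OF refl])

lemma cmod_index_le_vnorm: "i < dim_vec v \<Longrightarrow> cmod (v $ i) \<le> vnorm v"
  unfolding vnorm_eq_L2_set by (rule member_le_L2_set[where f = "\<lambda>i. cmod (v $ i)"]) auto

lemma vnorm_smult: "vnorm (a \<cdot>\<^sub>v v) = cmod a * vnorm v"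
  by (simp add: vnorm_eq_L2_set norm_mult L2_set_right_distrib cong: L2_set_cong_simp)

lemma vnorm_eq_0_iff: "v \<in> carrier_vec d \<Longrightarrow> vnorm v = 0 \<longleftrightarrow> v = 0\<^sub>v d"
  by (auto simp: vnorm_eq_L2_set L2_set_eq_0_iff)

lemma vnorm_unit_vec: "i < d \<Longrightarrow> vnorm (unit_vec d i) = 1"
  by (simp add: vnorm_def if_distrib[where f = "\<lambda>x. (cmod x)\<^sup>2"] cong: if_cong)

lemma cmod_cscalar_prod_le:
  assumes "v \<in> carrier_vec d" "u \<in> carrier_vec d"
  shows "cmod (v \<bullet>c u) \<le> vnorm v * vnorm u"
proof -
  have "cmod (v \<bullet>c u) \<le> (\<Sum>i<d. \<bar>cmod (v $ i)\<bar> * \<bar>cmod (u $ i)\<bar>)"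
    unfolding cscalar_prod_sum[OF assms(2)] by (rule order_trans[OF norm_sum]) (simp add: norm_mult)
  also have "\<dots> \<le> vnorm v * vnorm u"
    using assms L2_set_mult_ineq[of "\<lambda>i. cmod (v $ i)" "\<lambda>i. cmod (u $ i)" "{..<d}"]
    by (simp add: vnorm_eq_L2_set)
  finally show ?thesis .
qed

lemma vnorm_mult_mat_vec_le_sum_cmod:
  assumes A: "A \<in> carrier_mat r c" and v: "v \<in> carrier_vec c" "vnorm v \<le> 1"
  shows "vnorm (A *\<^sub>v v) \<le> (\<Sum>i<r. \<Sum>j<c. cmod (A $$ (i, j)))"
proof -
  have "cmod (v $ j) \<le> 1" if "j < c" for j
    using cmod_index_le_vnorm[of j v] v that by auto
  then have "cmod ((A *\<^sub>v v) $ i) \<le> (\<Sum>j<c. cmod (A $$ (i, j)))" if "i < r" for i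
    unfolding index_mult_mat_vec_sum[OF A v(1) that]
    by (intro sum_norm_le) (simp add: norm_mult mult_left_le)
  moreover have "vnorm (A *\<^sub>v v) \<le> (\<Sum>i<r. cmod ((A *\<^sub>v v) $ i))"
    using A L2_set_le_sum[of "{..<r}" "\<lambda>i. cmod ((A *\<^sub>v v) $ i)"]
    by (auto simp: vnorm_eq_L2_set simp del: index_mult_mat_vec)
  ultimately show ?thesis
    using sum_mono[of "{..<r}" "\<lambda>i. cmod ((A *\<^sub>v v) $ i)" "\<lambda>i. \<Sum>j<c. cmod (A $$ (i, j))"] by auto
qed

lemma vnorm_mult_mat_vec_le:
  assumes A: "A \<in> carrier_mat r c" and v: "v \<in> carrier_vec c"
  shows "vnorm (A *\<^sub>v v) \<le> opnorm A * vnorm v"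
proof (cases "vnorm v = 0")
  case True
  then have "v = 0\<^sub>v c" using vnorm_eq_0_iff[OF v] by simp
  then have "A *\<^sub>v v = 0\<^sub>v r" using A by auto
  then show ?thesis using True by (simp add: vnorm_def)
next
  case False
  define w where "w = complex_of_real (inverse (vnorm v)) \<cdot>\<^sub>v v"
  have w: "w \<in> carrier_vec c" "vnorm w \<le> 1"
    using False v by (simp_all add: w_def vnorm_smult norm_inverse)
  have "bdd_above {vnorm (A *\<^sub>v v) | v. v \<in> carrier_vec (dim_col A) \<and> vnorm v \<le> 1}"
    using A vnorm_mult_mat_vec_le_sum_cmod[OF A] by (intro bdd_aboveI) auto
  then have "vnorm (A *\<^sub>v w) \<le> opnorm A"
    unfolding opnorm_def using A w by (intro cSup_upper) auto
  moreover have "A *\<^sub>v w = complex_of_real (inverse (vnorm v)) \<cdot>\<^sub>v (A *\<^sub>v v)"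
    using A v by (simp add: w_def mult_mat_vec)
  ultimately have "inverse (vnorm v) * vnorm (A *\<^sub>v v) \<le> opnorm A"
    by (simp add: vnorm_smult norm_inverse)
  moreover have "vnorm v > 0" using False vnorm_nonneg[of v] by linarith
  ultimately show ?thesis by (simp add: field_simps)
qed

lemma opnorm_leI:
  assumes A: "A \<in> carrier_mat r c" and B: "0 \<le> B"
    and bound: "\<And>v. v \<in> carrier_vec c \<Longrightarrow> vnorm (A *\<^sub>v v) \<le> B * vnorm v"
  shows "opnorm A \<le> B"
  unfolding opnorm_def
proof (rule cSup_least)
  have "vnorm (0\<^sub>v c) \<le> 1" by (simp add: vnorm_def)
  then show "{vnorm (A *\<^sub>v v) | v. v \<in> carrier_vec (dim_col A) \<and> vnorm v \<le> 1} \<noteq> {}"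
    using A by (auto intro!: exI[of _ "0\<^sub>v c"])
  fix x assume "x \<in> {vnorm (A *\<^sub>v v) | v. v \<in> carrier_vec (dim_col A) \<and> vnorm v \<le> 1}"
  then obtain v where "x = vnorm (A *\<^sub>v v)" "v \<in> carrier_vec c" "vnorm v \<le> 1" using A by auto
  then show "x \<le> B" using bound[of v] mult_left_le[of "vnorm v" B] B by linarith
qed

lemma opnorm_nonneg:
  assumes "A \<in> carrier_mat r c"
  shows "0 \<le> opnorm A"
proof -
  have "vnorm (A *\<^sub>v 0\<^sub>v c) \<le> opnorm A"
    unfolding opnorm_def using assms vnorm_mult_mat_vec_le_sum_cmod[OF assms]
    by (intro cSup_upper bdd_aboveI) (auto simp: vnorm_def intro!: exI[of _ "0\<^sub>v c"])
  then show ?thesis using vnorm_nonneg order_trans by blast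
qed

lemma cmod_cscalar_prod_mult_mat_vec_le:
  assumes A: "A \<in> carrier_mat r c" and v: "v \<in> carrier_vec c" and u: "u \<in> carrier_vec r"
  shows "cmod ((A *\<^sub>v v) \<bullet>c u) \<le> opnorm A * vnorm v * vnorm u"
proof -
  have "cmod ((A *\<^sub>v v) \<bullet>c u) \<le> vnorm (A *\<^sub>v v) * vnorm u"
    by (rule cmod_cscalar_prod_le[OF mult_mat_vec_carrier[OF A v] u])
  also have "\<dots> \<le> opnorm A * vnorm v * vnorm u"
    using vnorm_mult_mat_vec_le[OF A v] by (intro mult_right_mono) auto
  finally show ?thesis .
qed

lemma opnorm_leI_cscalar_prod:
  assumes A: "A \<in> carrier_mat r c" and B: "0 \<le> B"
    and bound: "\<And>u v. u \<in> carrier_vec r \<Longrightarrow> v \<in> carrier_vec c \<Longrightarrow> cmod ((A *\<^sub>v v) \<bullet>c u)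
        \<le> B * vnorm v * vnorm u"
  shows "opnorm A \<le> B"
proof (rule opnorm_leI[OF A B])
  fix v :: "complex vec" assume v: "v \<in> carrier_vec c"
  have "(vnorm (A *\<^sub>v v))\<^sup>2 \<le> (B * vnorm v) * vnorm (A *\<^sub>v v)"
    using bound[OF mult_mat_vec_carrier[OF A v] v] unfolding cscalar_prod_self norm_of_real by simp
  then show "vnorm (A *\<^sub>v v) \<le> B * vnorm v"
    using B mult_right_le_imp_le[of "vnorm (A *\<^sub>v v)" "vnorm (A *\<^sub>v v)" "B * vnorm v"]
    by (cases "vnorm (A *\<^sub>v v) = 0") (auto simp: power2_eq_square less_le)
qed

lemma opnorm_zero: "opnorm (0\<^sub>m r c) = 0"
proof (rule antisym)
  show "opnorm (0\<^sub>m r c) \<le> 0" by (rule opnorm_leI[of _ r c]) (auto simp: vnorm_def)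
qed (rule opnorm_nonneg[OF zero_carrier_mat])

lemma opnorm_diff_le:
  assumes A: "A \<in> carrier_mat r c" and B: "B \<in> carrier_mat r c"
  shows "opnorm (A - B) \<le> opnorm A + opnorm B"
proof (rule opnorm_leI_cscalar_prod)
  fix u v :: "complex vec" assume u: "u \<in> carrier_vec r" and v: "v \<in> carrier_vec c"
  have "((A - B) *\<^sub>v v) \<bullet>c u = (A *\<^sub>v v) \<bullet>c u - (B *\<^sub>v v) \<bullet>c u"
    using A B u v by (simp add: minus_mult_distrib_mat_vec[OF A B v]
        minus_scalar_prod_distrib[of _ r])
  then show "cmod (((A - B) *\<^sub>v v) \<bullet>c u) \<le> (opnorm A + opnorm B) * vnorm v * vnorm u"
    using cmod_cscalar_prod_mult_mat_vec_le[OF A v u] cmod_cscalar_prod_mult_mat_vec_le[OF B v u]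
      norm_triangle_ineq4[of "(A *\<^sub>v v) \<bullet>c u" "(B *\<^sub>v v) \<bullet>c u"]
    by (simp add: distrib_right)
qed (use A B opnorm_nonneg[OF A] opnorm_nonneg[OF B] in auto)

lemma opnorm_mult_le:
  assumes A: "A \<in> carrier_mat r m" and B: "B \<in> carrier_mat m c"
  shows "opnorm (A * B) \<le> opnorm A * opnorm B"
proof (rule opnorm_leI)
  fix v :: "complex vec" assume v: "v \<in> carrier_vec c"
  have "vnorm (A * B *\<^sub>v v) \<le> opnorm A * vnorm (B *\<^sub>v v)"
    using A B v by (simp add: vnorm_mult_mat_vec_le)
  also have "\<dots> \<le> opnorm A * (opnorm B * vnorm v)"
    using vnorm_mult_mat_vec_le[OF B v] opnorm_nonneg[OF A] by (rule mult_left_mono)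
  finally show "vnorm (A * B *\<^sub>v v) \<le> opnorm A * opnorm B * vnorm v" by (simp add: mult.assoc)
qed (use A B opnorm_nonneg[OF A] opnorm_nonneg[OF B] in auto)

lemma opnorm_mult_mult_contraction_le:
  assumes A: "A \<in> carrier_mat r m" "opnorm A \<le> 1" and B: "B \<in> carrier_mat m m'"
    and C: "C \<in> carrier_mat m' c" "opnorm C \<le> 1"
  shows "opnorm (A * B * C) \<le> opnorm B"
proof -
  have AB: "A * B \<in> carrier_mat r m'" using A B by auto
  have "opnorm (A * B * C) \<le> opnorm (A * B)"
    using opnorm_mult_le[OF AB C(1)] mult_left_le[OF C(2) opnorm_nonneg[OF AB]] by linarith
  also have "\<dots> \<le> opnorm B"
    using opnorm_mult_le[OF A(1) B]
      mult_left_le_one_le[OF opnorm_nonneg[OF B] opnorm_nonneg[OF A(1)] A(2)]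
    by linarith
  finally show ?thesis .
qed

lemma opnorm_ctrans_le:
  assumes A: "A \<in> carrier_mat r c"
  shows "opnorm (ctrans A) \<le> opnorm A"
proof (rule opnorm_leI_cscalar_prod)
  fix u v :: "complex vec" assume u: "u \<in> carrier_vec c" and v: "v \<in> carrier_vec r"
  have "(ctrans A *\<^sub>v v) \<bullet>c u = v \<bullet>c (A *\<^sub>v u)"
    using A u v cscalar_prod_mult_mat_vec[of "ctrans A" c r v u] by simp
  also have "cmod \<dots> \<le> vnorm v * vnorm (A *\<^sub>v u)"
    using A u v by (intro cmod_cscalar_prod_le) auto
  also have "\<dots> \<le> vnorm v * (opnorm A * vnorm u)"
    using vnorm_mult_mat_vec_le[OF A u] by (rule mult_left_mono) simp
  finally show "cmod ((ctrans A *\<^sub>v v) \<bullet>c u) \<le> opnorm A * vnorm v * vnorm u" by (simp add: mult_ac)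
qed (use A opnorm_nonneg[OF A] in auto)

lemma opnorm_contraction_conjugation_le:
  assumes V: "V \<in> carrier_mat d e" "opnorm V \<le> 1" and X: "X \<in> carrier_mat d d"
  shows "opnorm (ctrans V * X * V) \<le> opnorm X"
  using V opnorm_ctrans_le[OF V(1)] by (intro opnorm_mult_mult_contraction_le[OF _ _ X]) auto

lemma cmod_index_le_opnorm:
  assumes A: "A \<in> carrier_mat r c" and ij: "i < r" "j < c"
  shows "cmod (A $$ (i, j)) \<le> opnorm A"
proof -
  have "cmod (A $$ (i, j)) = cmod ((A *\<^sub>v unit_vec c j) $ i)" using A ij by simp
  also have "\<dots> \<le> vnorm (A *\<^sub>v unit_vec c j)" using A ij by (intro cmod_index_le_vnorm) auto
  also have "\<dots> \<le> opnorm A"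
    using vnorm_mult_mat_vec_le[OF A unit_vec_carrier, of j] ij by (simp add: vnorm_unit_vec)
  finally show ?thesis .
qed

lemma opnorm_mat_lincomb_le:
  assumes F: "\<And>l. l \<in> L \<Longrightarrow> F l \<in> carrier_mat d d"
  shows "opnorm (mat_lincomb d L c F) \<le> (\<Sum>l\<in>L. cmod (c l) * opnorm (F l))"
proof (rule opnorm_leI_cscalar_prod)
  fix u v :: "complex vec" assume u: "u \<in> carrier_vec d" and v: "v \<in> carrier_vec d"
  have "cmod ((mat_lincomb d L c F *\<^sub>v v) \<bullet>c u)
      \<le> (\<Sum>l\<in>L. cmod (c l) * (opnorm (F l) * vnorm v * vnorm u))"
    by (subst cscalar_prod_mat_lincomb_mult_vec[OF _ v u], rule F, assumption, intro sum_norm_le)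
      (auto simp: norm_mult intro!: mult_left_mono cmod_cscalar_prod_mult_mat_vec_le[OF F v u])
  then show "cmod ((mat_lincomb d L c F *\<^sub>v v) \<bullet>c u)
      \<le> (\<Sum>l\<in>L. cmod (c l) * opnorm (F l)) * vnorm v * vnorm u"
    by (simp add: sum_distrib_right mult.assoc)
qed (use F opnorm_nonneg in \<open>auto intro!: sum_nonneg mult_nonneg_nonneg\<close>)

lemma opnorm_isometry_le:
  assumes V: "V \<in> carrier_mat r c" and VV: "ctrans V * V = 1\<^sub>m c"
  shows "opnorm V \<le> 1"
proof (rule opnorm_leI[OF V])
  fix v :: "complex vec" assume v: "v \<in> carrier_vec c"
  have "(V *\<^sub>v v) \<bullet>c (V *\<^sub>v v) = v \<bullet>c (ctrans V * V *\<^sub>v v)"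
    using V v cscalar_prod_mult_mat_vec[OF V v, of "V *\<^sub>v v"]
    by (simp add: assoc_mult_mat_vec[of _ c r])
  then have "(vnorm (V *\<^sub>v v))\<^sup>2 = (vnorm v)\<^sup>2"
    using v unfolding VV cscalar_prod_self by (simp add: cscalar_prod_self flip: of_real_power)
  then show "vnorm (V *\<^sub>v v) \<le> 1 * vnorm v" by simp
qed simp

lemma opnorm_munit_le:
  assumes j: "j < d"
  shows "opnorm (munit d i j) \<le> 1"
proof (rule opnorm_leI)
  fix v :: "complex vec" assume v: "v \<in> carrier_vec d"
  have entry: "(munit d i j *\<^sub>v v) $ a = (if a = i then v $ j else 0)" if "a < d" for a
    unfolding index_mult_mat_vec_sum[OF munit_carrier v that] using that j
    by (simp add: if_distrib[where f = "\<lambda>x. x * _"] cong: if_cong)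
  then have "vnorm (munit d i j *\<^sub>v v) = L2_set (\<lambda>a. if a = i then cmod (v $ j) else 0) {..<d}"
    unfolding vnorm_eq_L2_set by (intro L2_set_cong) (auto simp del: index_mult_mat_vec)
  also have "\<dots> \<le> vnorm v"
    using v j cmod_index_le_vnorm[of j v]
    by (auto simp: L2_set_def if_distrib[where f = "\<lambda>x. x\<^sup>2"] cong: if_cong)
  finally show "vnorm (munit d i j *\<^sub>v v) \<le> 1 * vnorm v" by simp
qed auto

lemma opnorm_kron_one_le:
  assumes A: "A \<in> carrier_mat r c"
  shows "opnorm (kron (1\<^sub>m m) A) \<le> opnorm A"
proof (rule opnorm_leI)
  have K: "kron (1\<^sub>m m) A \<in> carrier_mat (m * r) (m * c)" using A by simp
  fix v :: "complex vec" assume v: "v \<in> carrier_vec (m * c)"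
  define slice where "slice a = vec c (\<lambda>j. v $ (a * c + j))" for a
  have slice: "slice a \<in> carrier_vec c" for a by (simp add: slice_def)
  have block: "(kron (1\<^sub>m m) A *\<^sub>v v) $ (a * r + i) = (A *\<^sub>v slice a) $ i" if ai: "a < m" "i < r"
    for a i
  proof -
    have "(kron (1\<^sub>m m) A *\<^sub>v v) $ (a * r + i)
        = (\<Sum>b<m. \<Sum>j<c. kron (1\<^sub>m m) A $$ (a * r + i, b * c + j) * v $ (b * c + j))"
      unfolding index_mult_mat_vec_sum[OF K v mult_add_less_mult[OF ai]] by (rule sum_lessThan_mult)
    also have "\<dots> = (\<Sum>b<m. if b = a then \<Sum>j<c. A $$ (i, j) * slice a $ j else 0)"
      using ai by (intro sum.cong refl)
        (auto simp: index_kron_mult_add[OF one_carrier_mat A] slice_def)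
    also have "\<dots> = (A *\<^sub>v slice a) $ i"
      using ai by (simp add: index_mult_mat_vec_sum[OF A slice] del: index_mult_mat_vec)
    finally show ?thesis .
  qed
  have "(vnorm (kron (1\<^sub>m m) A *\<^sub>v v))\<^sup>2 = (\<Sum>a<m. (vnorm (A *\<^sub>v slice a))\<^sup>2)"
    using A by (simp add: vnorm_power2 sum_lessThan_mult block del: index_mult_mat_vec)
  also have "\<dots> \<le> (\<Sum>a<m. (opnorm A * vnorm (slice a))\<^sup>2)"
    by (intro sum_mono power_mono vnorm_mult_mat_vec_le[OF A slice]) simp
  also have "\<dots> = (opnorm A * vnorm v)\<^sup>2"
  proof -
    have "(\<Sum>a<m. (vnorm (slice a))\<^sup>2) = (vnorm v)\<^sup>2"
      using v by (simp add: vnorm_power2 sum_lessThan_mult slice_def)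
    then show ?thesis by (simp add: power_mult_distrib flip: sum_distrib_left)
  qed
  finally show "vnorm (kron (1\<^sub>m m) A *\<^sub>v v) \<le> opnorm A * vnorm v"
    by (rule power2_le_imp_le) (simp add: opnorm_nonneg[OF A])
qed (use A opnorm_nonneg[OF A] in auto)

section \<open>Completely bounded norms\<close>

abbreviation quadruples :: "nat \<Rightarrow> (nat \<times> nat \<times> nat \<times> nat) set" where
  "quadruples d \<equiv> {..<d} \<times> {..<d} \<times> {..<d} \<times> {..<d}"

definition map_entry :: "nat \<Rightarrow> (complex mat \<Rightarrow> complex mat) \<Rightarrow> nat \<times> nat \<times> nat \<times> nat \<Rightarrow> complex" where
  "map_entry d T = (\<lambda>(p, q, r, s). T (munit d p q) $$ (r, s))"

lemma linear_on_eq_lincomb_munit_mult: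
  assumes T: "linear_on d T" and y: "y \<in> carrier_mat d d"
  shows "T y = mat_lincomb d (quadruples d) (map_entry d T)
      (\<lambda>(p, q, r, s). munit d r p * y * munit d q s)"
    (is "_ = ?rhs")
proof (rule eq_mat_dimI)
  fix a b assume ab: "a < d" "b < d"
  have "?rhs $$ (a, b) = (\<Sum>p<d. \<Sum>q<d. \<Sum>r<d. \<Sum>s<d.
      if s = b then if r = a then y $$ (p, q) * T (munit d p q) $$ (a, b) else 0 else 0)"
    unfolding index_mat_lincomb[OF ab] sum.cartesian_product' map_entry_def using ab
    by (intro sum.cong refl) (auto simp: munit_mult_mult_munit[OF y] simp del: assoc_mult_mat)
  also have "\<dots> = T y $$ (a, b)"
    using ab by (simp add: linear_on_index[OF T y ab])
  finally show "T y $$ (a, b) = ?rhs $$ (a, b)" ..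
qed (use linear_on_carrier[OF T y] in auto)

lemma amplification_eq_lincomb_munit_mult:
  assumes T: "linear_on d T" and z: "z \<in> carrier_mat (m * d) (m * d)"
  shows "amplification m d T z = mat_lincomb (m * d) (quadruples d) (map_entry d T)
    (\<lambda>(p, q, r, s). kron (1\<^sub>m m) (munit d r p) * z * kron (1\<^sub>m m) (munit d q s))"
proof (rule linear_on_tensor_eqI[OF linear_on_tensor_map _ _ z])
  have K: "kron (1\<^sub>m m) (munit d i j) \<in> carrier_mat (m * d) (m * d)" for i j by simp
  show "linear_on (m * d) (\<lambda>z. mat_lincomb (m * d) (quadruples d) (map_entry d T)
    (\<lambda>(p, q, r, s). kron (1\<^sub>m m) (munit d r p) * z * kron (1\<^sub>m m) (munit d q s)))"
    unfolding case_prod_unfold by (intro linear_on_mat_lincomb linear_on_mult_mult K)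
  fix x y :: "complex mat" assume x: "x \<in> carrier_mat m m" and y: "y \<in> carrier_mat d d"
  have "amplification m d T (kron x y) = kron x (T y)"
    by (rule tensor_map_kron[OF linear_on_id T x y])
  also have "\<dots> = mat_lincomb (m * d) (quadruples d) (map_entry d T)
    (\<lambda>(p, q, r, s). kron (1\<^sub>m m) (munit d r p) * kron x y * kron (1\<^sub>m m) (munit d q s))"
    unfolding kron_one_mult_kron_mult[OF munit_carrier munit_carrier x y] case_prod_unfold
    by (subst linear_on_eq_lincomb_munit_mult[OF T y], unfold case_prod_unfold,
        rule kron_mat_lincomb[OF x])
      (rule mult_mult_carrier_mat[OF munit_carrier y munit_carrier])
  finally show "amplification m d T (kron x y) = mat_lincomb (m * d) (quadruples d) (map_entry d T)
    (\<lambda>(p, q, r, s). kron (1\<^sub>m m) (munit d r p) * kron x y * kron (1\<^sub>m m) (munit d q s))" .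
qed

lemma opnorm_kron_one_munit_mult_le:
  assumes z: "z \<in> carrier_mat (m * d) (m * d)" and "j < d" "l < d"
  shows "opnorm (kron (1\<^sub>m m) (munit d i j) * z * kron (1\<^sub>m m) (munit d k l)) \<le> opnorm z"
proof -
  have "opnorm (kron (1\<^sub>m m) (munit d i j)) \<le> 1" if "j < d" for i j
    using opnorm_kron_one_le[OF munit_carrier, of m d i j] opnorm_munit_le[OF that, of i]
    by linarith
  then show ?thesis using assms by (intro opnorm_mult_mult_contraction_le[OF _ _ z]) auto
qed

text \<open>The bound does not depend on m, so the supremum defining the cb-norm is over a bounded set.\<close>

lemma opnorm_amplification_le_sum_map_entry:
  assumes T: "linear_on d T" and z: "z \<in> carrier_mat (m * d) (m * d)" "opnorm z \<le> 1"
  shows "opnorm (amplification m d T z) \<le> (\<Sum>l\<in>quadruples d. cmod (map_entry d T l))"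
proof -
  let ?F = "\<lambda>(p, q, r, s). kron (1\<^sub>m m) (munit d r p) * z * kron (1\<^sub>m m) (munit d q s)"
  have K: "kron (1\<^sub>m m) (munit d i j) \<in> carrier_mat (m * d) (m * d)" for i j by simp
  have F: "?F l \<in> carrier_mat (m * d) (m * d)" for l
    unfolding case_prod_unfold by (rule mult_mult_carrier_mat[OF K z(1) K])
  have "opnorm (?F l) \<le> 1" if "l \<in> quadruples d" for l
    using that order_trans[OF opnorm_kron_one_munit_mult_le[OF z(1)] z(2)]
    by (auto simp del: assoc_mult_mat)
  then have "(\<Sum>l\<in>quadruples d. cmod (map_entry d T l) * opnorm (?F l))
      \<le> (\<Sum>l\<in>quadruples d. cmod (map_entry d T l))"
    by (intro sum_mono mult_left_le) auto
  then show ?thesis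
    unfolding amplification_eq_lincomb_munit_mult[OF T z(1)]
    using opnorm_mat_lincomb_le[of "quadruples d" ?F "m * d" "map_entry d T", OF F] by linarith
qed

lemma cb_norm_leI:
  assumes bound: "\<And>m z. \<lbrakk>1 \<le> m; z \<in> carrier_mat (m * d) (m * d); opnorm z \<le> 1\<rbrakk>
    \<Longrightarrow> opnorm (amplification m d T z) \<le> C"
  shows "cb_norm d T \<le> C"
  unfolding cb_norm_def
proof (rule cSup_least)
  fix x assume "x \<in> {map_norm (m * d) (amplification m d T) | m. 1 \<le> m}"
  then obtain m where m: "x = map_norm (m * d) (amplification m d T)" "1 \<le> m" by blast
  have "{opnorm (amplification m d T z) | z. z \<in> carrier_mat (m * d) (m * d) \<and> opnorm z \<le> 1} \<noteq> {}"
    by (auto intro!: exI[of _ "0\<^sub>m (m * d) (m * d)"] simp: opnorm_zero)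
  then show "x \<le> C"
    unfolding m(1) map_norm_def by (rule cSup_least) (use bound[OF m(2)] in blast)
qed auto

lemma opnorm_amplification_le:
  assumes T: "linear_on d T" and m: "1 \<le> m" and z: "z \<in> carrier_mat (m * d) (m * d)" "opnorm z \<le> 1"
  shows "opnorm (amplification m d T z) \<le> cb_norm d T"
proof -
  let ?C = "\<Sum>l\<in>quadruples d. cmod (map_entry d T l)"
  note bound = opnorm_amplification_le_sum_map_entry[OF T]
  have le_map_norm: "opnorm (amplification m d T z) \<le> map_norm (m * d) (amplification m d T)"
    if "z \<in> carrier_mat (m * d) (m * d)" "opnorm z \<le> 1" for m z
    unfolding map_norm_def using that bound by (intro cSup_upper bdd_aboveI[of _ ?C]) auto
  have "map_norm (m * d) (amplification m d T) \<le> ?C" for m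
    unfolding map_norm_def using bound
    by (intro cSup_least) (auto intro!: exI[of _ "0\<^sub>m (m * d) (m * d)"] simp: opnorm_zero)
  then have "map_norm (m * d) (amplification m d T) \<le> cb_norm d T"
    unfolding cb_norm_def using m by (intro cSup_upper bdd_aboveI[of _ ?C]) auto
  then show ?thesis using le_map_norm[OF z] by linarith
qed

lemma opnorm_apply_le_cb_norm:
  assumes T: "linear_on d T" and "x \<in> carrier_mat d d" "opnorm x \<le> 1"
  shows "opnorm (T x) \<le> cb_norm d T"
  using opnorm_amplification_le[OF T, of 1 x] amplification_1[OF T] assms by simp

lemma cb_norm_nonneg:
  assumes T: "linear_on d T"
  shows "0 \<le> cb_norm d T"
  using opnorm_apply_le_cb_norm[OF T zero_carrier_mat]
  by (simp add: opnorm_zero linear_on_zero[OF T])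

lemma cb_norm_cong:
  assumes "\<And>x. x \<in> carrier_mat d d \<Longrightarrow> T x = S x"
  shows "cb_norm d T = cb_norm d S"
proof -
  have "amplification m d T = amplification m d S" for m
    unfolding tensor_map_def using assms by simp
  then show ?thesis by (simp add: cb_norm_def)
qed

lemma amplification_diff:
  assumes T: "linear_on d T" and S: "linear_on d S"
  shows "amplification m d (\<lambda>x. T x - S x) z = amplification m d T z - amplification m d S z"
proof (rule eq_mat_dimI)
  fix i j assume ij: "i < m * d" "j < m * d"
  have "kron x (T (munit d p q) - S (munit d p q)) $$ (i, j)
      = kron x (T (munit d p q)) $$ (i, j) - kron x (S (munit d p q)) $$ (i, j)"
    if x: "x \<in> carrier_mat m m" for x p q
    using ij x linear_on_carrier[OF T munit_carrier, of p q]
      linear_on_carrier[OF S munit_carrier, of p q]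
      div_mod_less_mult[OF ij(1)] div_mod_less_mult[OF ij(2)]
    by (simp add: index_kron[OF x _ ij] right_diff_distrib minus_carrier_mat)
  then show "amplification m d (\<lambda>x. T x - S x) z $$ (i, j)
      = (amplification m d T z - amplification m d S z) $$ (i, j)"
    using ij by (simp add: tensor_map_def right_diff_distrib sum_subtractf)
qed (auto simp: tensor_map_def)

lemma cb_norm_diff_le:
  assumes T: "linear_on d T" and S: "linear_on d S"
  shows "cb_norm d (\<lambda>x. T x - S x) \<le> cb_norm d T + cb_norm d S"
proof (rule cb_norm_leI)
  fix m :: nat and z assume m: "1 \<le> m" and z: "z \<in> carrier_mat (m * d) (m * d)" "opnorm z \<le> 1"
  have "opnorm (amplification m d (\<lambda>x. T x - S x) z)
      \<le> opnorm (amplification m d T z) + opnorm (amplification m d S z)"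
    unfolding amplification_diff[OF T S]
    by (rule opnorm_diff_le[OF tensor_map_carrier[OF z(1)] tensor_map_carrier[OF z(1)]])
  then show "opnorm (amplification m d (\<lambda>x. T x - S x) z) \<le> cb_norm d T + cb_norm d S"
    using opnorm_amplification_le[OF T m z] opnorm_amplification_le[OF S m z] by linarith
qed

lemma opnorm_kron_one_isometry_le:
  assumes V: "V \<in> carrier_mat d e" and "ctrans V * V = 1\<^sub>m e"
  shows "opnorm (kron (1\<^sub>m m) V) \<le> 1"
  using opnorm_kron_one_le[OF V, of m] opnorm_isometry_le[OF assms] by linarith

lemma cb_norm_compression_le:
  assumes T: "linear_on d T" and V: "V \<in> carrier_mat d e" "ctrans V * V = 1\<^sub>m e"
  shows "cb_norm e (\<lambda>x. ctrans V * T (V * x * ctrans V) * V) \<le> cb_norm d T"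
proof (rule cb_norm_leI)
  fix m :: nat and z assume m: "1 \<le> m" and z: "z \<in> carrier_mat (m * e) (m * e)" "opnorm z \<le> 1"
  define W where "W = kron (1\<^sub>m m) V"
  have W: "W \<in> carrier_mat (m * d) (m * e)" "opnorm W \<le> 1"
    using V(1) opnorm_kron_one_isometry_le[OF V] by (simp_all add: W_def)
  have Wc: "ctrans W \<in> carrier_mat (m * e) (m * d)" "opnorm (ctrans W) \<le> 1"
    using W opnorm_ctrans_le[OF W(1)] by auto
  have "W * z * ctrans W \<in> carrier_mat (m * d) (m * d)" using W Wc z by auto
  moreover have "opnorm (W * z * ctrans W) \<le> 1"
    using opnorm_mult_mult_contraction_le[OF W z(1) Wc] z(2) by linarith
  ultimately have "opnorm (amplification m d T (W * z * ctrans W)) \<le> cb_norm d T"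
    by (rule opnorm_amplification_le[OF T m])
  then show "opnorm (amplification m e (\<lambda>x. ctrans V * T (V * x * ctrans V) * V) z) \<le> cb_norm d T"
    unfolding amplification_conjugation[OF T V(1) z(1)] W_def[symmetric]
    using opnorm_contraction_conjugation_le[OF W tensor_map_carrier] \<open>W * z * ctrans W \<in> _\<close>
    by (meson order_trans)
qed

section \<open>Kraus maps\<close>

definition kraus_map ::
    "nat \<Rightarrow> 'l set \<Rightarrow> ('l \<Rightarrow> real) \<Rightarrow> ('l \<Rightarrow> complex mat) \<Rightarrow> complex mat \<Rightarrow> complex mat" where
  "kraus_map d L lam A x
      = mat_lincomb d L (\<lambda>l. complex_of_real (lam l)) (\<lambda>l. ctrans (A l) * x * A l)"

lemma kraus_map_carrier [simp]: "kraus_map d L lam A x \<in> carrier_mat d d"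
  by (simp add: kraus_map_def)

lemma dim_kraus_map [simp]: "dim_row (kraus_map d L lam A x) = d"
  "dim_col (kraus_map d L lam A x) = d"
  by (simp_all add: kraus_map_def)

lemma ctrans_mult_mult_carrier:
  "A \<in> carrier_mat d e \<Longrightarrow> x \<in> carrier_mat d d \<Longrightarrow> ctrans A * x * A \<in> carrier_mat e e"
  by auto

lemma linear_on_kraus_map:
  assumes "\<And>l. l \<in> L \<Longrightarrow> A l \<in> carrier_mat d d"
  shows "linear_on d (kraus_map d L lam A)"
  unfolding kraus_map_def[abs_def] using assms
  by (intro linear_on_mat_lincomb linear_on_mult_mult) auto

lemma kraus_map_kron_one:
  assumes A: "\<And>l. l \<in> L \<Longrightarrow> A l \<in> carrier_mat d d" and x: "x \<in> carrier_mat m m"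
    and y: "y \<in> carrier_mat d d"
  shows "kraus_map (m * d) L lam (\<lambda>l. kron (1\<^sub>m m) (A l)) (kron x y)
      = kron x (kraus_map d L lam A y)"
proof -
  have "ctrans (kron (1\<^sub>m m) (A l)) * kron x y * kron (1\<^sub>m m) (A l)
      = kron x (ctrans (A l) * y * A l)"
    if "l \<in> L" for l
    unfolding ctrans_kron ctrans_one using A[OF that]
    by (intro kron_one_mult_kron_mult[OF _ _ x y]) auto
  moreover have "kron x (kraus_map d L lam A y)
      = mat_lincomb (m * d) L (\<lambda>l. complex_of_real (lam l)) (\<lambda>l. kron x (ctrans (A l) * y * A l))"
    unfolding kraus_map_def by (rule kron_mat_lincomb[OF x]) (rule ctrans_mult_mult_carrier[OF A y])
  ultimately show ?thesis unfolding kraus_map_def by (simp cong: mat_lincomb_cong)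
qed

lemma amplification_kraus_map:
  assumes A: "\<And>l. l \<in> L \<Longrightarrow> A l \<in> carrier_mat d d" and z: "z \<in> carrier_mat (m * d) (m * d)"
  shows "amplification m d (kraus_map d L lam A) z
      = kraus_map (m * d) L lam (\<lambda>l. kron (1\<^sub>m m) (A l)) z"
proof (rule linear_on_tensor_eqI[OF linear_on_tensor_map _ _ z])
  show "linear_on (m * d) (kraus_map (m * d) L lam (\<lambda>l. kron (1\<^sub>m m) (A l)))"
    using A by (intro linear_on_kraus_map) simp
  show "amplification m d (kraus_map d L lam A) (kron x y)
      = kraus_map (m * d) L lam (\<lambda>l. kron (1\<^sub>m m) (A l)) (kron x y)"
    if "x \<in> carrier_mat m m" "y \<in> carrier_mat d d" for x y
    using that by (simp add: tensor_map_kron[OF linear_on_id linear_on_kraus_map[OF A]]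
        kraus_map_kron_one[OF A])
qed

lemma cscalar_prod_kraus_map_mult_vec:
  assumes A: "\<And>l. l \<in> L \<Longrightarrow> A l \<in> carrier_mat d d" and x: "x \<in> carrier_mat d d"
    and v: "v \<in> carrier_vec d" and u: "u \<in> carrier_vec d"
  shows "(kraus_map d L lam A x *\<^sub>v v) \<bullet>c u
    = (\<Sum>l\<in>L. complex_of_real (lam l) * ((x *\<^sub>v (A l *\<^sub>v v)) \<bullet>c (A l *\<^sub>v u)))"
proof -
  have "((ctrans (A l) * x * A l) *\<^sub>v v) \<bullet>c u = (x *\<^sub>v (A l *\<^sub>v v)) \<bullet>c (A l *\<^sub>v u)" if "l \<in> L" for l
  proof -
    have "(ctrans (A l) * x * A l) *\<^sub>v v = ctrans (A l) *\<^sub>v (x *\<^sub>v (A l *\<^sub>v v))"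
      using A[OF that] x v by (simp add: assoc_mult_mat_vec[of _ d d _ d]
          mult_carrier_mat[of _ d d _ d] del: assoc_mult_mat)
    then show ?thesis
      using A[OF that] x v u cscalar_prod_mult_mat_vec[of "ctrans (A l)" d d "x *\<^sub>v (A l *\<^sub>v v)" u]
      by simp
  qed
  moreover have "(kraus_map d L lam A x *\<^sub>v v) \<bullet>c u
      = (\<Sum>l\<in>L. complex_of_real (lam l) * (((ctrans (A l) * x * A l) *\<^sub>v v) \<bullet>c u))"
    unfolding kraus_map_def
    by (rule cscalar_prod_mat_lincomb_mult_vec[OF _ v u]) (rule ctrans_mult_mult_carrier[OF A x])
  ultimately show ?thesis by simp
qed

lemma sum_vnorm_power2_le_opnorm_kraus_map:
  assumes lam: "\<And>l. l \<in> L \<Longrightarrow> 0 \<le> lam l" and A: "\<And>l. l \<in> L \<Longrightarrow> A l \<in> carrier_mat d d"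
    and v: "v \<in> carrier_vec d"
  shows "(\<Sum>l\<in>L. lam l * (vnorm (A l *\<^sub>v v))\<^sup>2) \<le> opnorm (kraus_map d L lam A (1\<^sub>m d)) * (vnorm v)\<^sup>2"
proof -
  have "(1\<^sub>m d *\<^sub>v (A l *\<^sub>v v)) \<bullet>c (A l *\<^sub>v v) = complex_of_real ((vnorm (A l *\<^sub>v v))\<^sup>2)" if "l \<in> L"
    for l
    unfolding one_mult_mat_vec[OF mult_mat_vec_carrier[OF A[OF that] v]] by (rule cscalar_prod_self)
  then have "(kraus_map d L lam A (1\<^sub>m d) *\<^sub>v v) \<bullet>c v
      = complex_of_real (\<Sum>l\<in>L. lam l * (vnorm (A l *\<^sub>v v))\<^sup>2)"
    using cscalar_prod_kraus_map_mult_vec[of L A d "1\<^sub>m d" v v lam] A v by simp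
  then have "(\<Sum>l\<in>L. lam l * (vnorm (A l *\<^sub>v v))\<^sup>2)
      \<le> cmod ((kraus_map d L lam A (1\<^sub>m d) *\<^sub>v v) \<bullet>c v)"
    by (simp only: norm_of_real abs_ge_self)
  also have "\<dots> \<le> opnorm (kraus_map d L lam A (1\<^sub>m d)) * vnorm v * vnorm v"
    by (rule cmod_cscalar_prod_mult_mat_vec_le[OF kraus_map_carrier v v])
  finally show ?thesis by (simp add: power2_eq_square mult.assoc)
qed

lemma opnorm_kraus_map_le:
  assumes lam: "\<And>l. l \<in> L \<Longrightarrow> 0 \<le> lam l" and A: "\<And>l. l \<in> L \<Longrightarrow> A l \<in> carrier_mat d d"
    and x: "x \<in> carrier_mat d d"
  shows "opnorm (kraus_map d L lam A x) \<le> opnorm x * opnorm (kraus_map d L lam A (1\<^sub>m d))"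
proof (rule opnorm_leI_cscalar_prod)
  let ?g = "opnorm (kraus_map d L lam A (1\<^sub>m d))"
  have unit_norm_nonneg: "0 \<le> ?g" by (rule opnorm_nonneg[OF kraus_map_carrier])
  then show "0 \<le> opnorm x * ?g" using opnorm_nonneg[OF x] by simp
  fix u v :: "complex vec" assume u: "u \<in> carrier_vec d" and v: "v \<in> carrier_vec d"
  define a where "a w l = sqrt (lam l) * vnorm (A l *\<^sub>v w)" for w l
  have L2_set_le: "L2_set (a w) L \<le> sqrt ?g * vnorm w" if w: "w \<in> carrier_vec d" for w
  proof -
    have "(L2_set (a w) L)\<^sup>2 = (\<Sum>l\<in>L. lam l * (vnorm (A l *\<^sub>v w))\<^sup>2)"
      using lam by (simp add: L2_set_def a_def power_mult_distrib sum_nonneg)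
    also have "\<dots> \<le> ?g * (vnorm w)\<^sup>2" by (rule sum_vnorm_power2_le_opnorm_kraus_map[OF lam A w])
    also have "\<dots> = (sqrt ?g * vnorm w)\<^sup>2" using unit_norm_nonneg by (simp add: power_mult_distrib)
    finally show ?thesis by (rule power2_le_imp_le) (simp add: unit_norm_nonneg)
  qed
  have term_le: "cmod (complex_of_real (lam l) * ((x *\<^sub>v (A l *\<^sub>v v)) \<bullet>c (A l *\<^sub>v u)))
      \<le> opnorm x * (\<bar>a v l\<bar> * \<bar>a u l\<bar>)" if "l \<in> L" for l
  proof -
    have "cmod ((x *\<^sub>v (A l *\<^sub>v v)) \<bullet>c (A l *\<^sub>v u))
        \<le> opnorm x * vnorm (A l *\<^sub>v v) * vnorm (A l *\<^sub>v u)"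
      using A[OF that] u v by (intro cmod_cscalar_prod_mult_mat_vec_le[OF x]) auto
    from mult_left_mono[OF this lam[OF that]]
    have "lam l * cmod ((x *\<^sub>v (A l *\<^sub>v v)) \<bullet>c (A l *\<^sub>v u))
        \<le> sqrt (lam l) * sqrt (lam l) * (opnorm x * vnorm (A l *\<^sub>v v) * vnorm (A l *\<^sub>v u))"
      using lam[OF that] by simp
    then show ?thesis using lam[OF that]
      by (simp only: a_def norm_mult norm_of_real abs_mult mult_ac) simp
  qed
  have "cmod ((kraus_map d L lam A x *\<^sub>v v) \<bullet>c u) \<le> (\<Sum>l\<in>L. opnorm x * (\<bar>a v l\<bar> * \<bar>a u l\<bar>))"
    by (subst cscalar_prod_kraus_map_mult_vec[OF _ x v u], rule A, assumption,
        rule sum_norm_le[OF term_le])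
  also have "\<dots> \<le> opnorm x * (L2_set (a v) L * L2_set (a u) L)"
    unfolding sum_distrib_left[symmetric] using opnorm_nonneg[OF x]
    by (intro mult_left_mono L2_set_mult_ineq)
  also have "\<dots> \<le> opnorm x * ((sqrt ?g * vnorm v) * (sqrt ?g * vnorm u))"
    using opnorm_nonneg[OF x] unit_norm_nonneg by (intro mult_left_mono mult_mono L2_set_le u v) auto
  also have "\<dots> = opnorm x * ?g * vnorm v * vnorm u" using unit_norm_nonneg by (simp add: mult_ac)
  finally show "cmod ((kraus_map d L lam A x *\<^sub>v v) \<bullet>c u) \<le> opnorm x * ?g * vnorm v * vnorm u" .
qed simp

lemma cb_norm_kraus_map_le:
  assumes lam: "\<And>l. l \<in> L \<Longrightarrow> 0 \<le> lam l" and A: "\<And>l. l \<in> L \<Longrightarrow> A l \<in> carrier_mat d d"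
  shows "cb_norm d (kraus_map d L lam A) \<le> opnorm (kraus_map d L lam A (1\<^sub>m d))"
proof (rule cb_norm_leI)
  fix m :: nat and z assume z: "z \<in> carrier_mat (m * d) (m * d)" "opnorm z \<le> 1"
  let ?K = "kraus_map (m * d) L lam (\<lambda>l. kron (1\<^sub>m m) (A l))"
  have "opnorm (?K z) \<le> opnorm z * opnorm (?K (1\<^sub>m (m * d)))"
    using lam A z by (intro opnorm_kraus_map_le) auto
  also have "\<dots> \<le> opnorm (?K (1\<^sub>m (m * d)))"
    using z(2) opnorm_nonneg[OF z(1)] opnorm_nonneg[OF kraus_map_carrier]
    by (intro mult_left_le_one_le)
  also have "?K (1\<^sub>m (m * d)) = kron (1\<^sub>m m) (kraus_map d L lam A (1\<^sub>m d))"
    using kraus_map_kron_one[of L A d "1\<^sub>m m" m "1\<^sub>m d" lam] A by (simp add: kron_one)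
  also have "opnorm \<dots> \<le> opnorm (kraus_map d L lam A (1\<^sub>m d))"
    by (rule opnorm_kron_one_le[OF kraus_map_carrier])
  finally show "opnorm (amplification m d (kraus_map d L lam A) z)
      \<le> opnorm (kraus_map d L lam A (1\<^sub>m d))"
    using amplification_kraus_map[of L A d z m lam] A z by simp
qed

lemma kraus_map_compression:
  assumes A: "\<And>l. l \<in> L \<Longrightarrow> A l \<in> carrier_mat d d" and V: "V \<in> carrier_mat d e"
    and x: "x \<in> carrier_mat e e"
  shows "ctrans V * kraus_map d L lam A (V * x * ctrans V) * V
      = kraus_map e L lam (\<lambda>l. ctrans V * A l * V) x"
proof -
  have VxV: "V * x * ctrans V \<in> carrier_mat d d" using V x by auto
  have "ctrans V * (ctrans (A l) * (V * x * ctrans V) * A l) * V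
      = ctrans (ctrans V * A l * V) * x * (ctrans V * A l * V)" if "l \<in> L" for l
    using A[OF that] V x by (simp add: ctrans_mult assoc_mult_mat_dim carrier_matD
        del: assoc_mult_mat)
  moreover have "ctrans V * kraus_map d L lam A (V * x * ctrans V) * V
      = mat_lincomb e L (\<lambda>l. complex_of_real (lam l))
        (\<lambda>l. ctrans V * (ctrans (A l) * (V * x * ctrans V) * A l) * V)"
    unfolding kraus_map_def using V
    by (intro mult_mat_lincomb_mult) (auto intro!: ctrans_mult_mult_carrier[OF A VxV]
        simp del: assoc_mult_mat)
  ultimately show ?thesis unfolding kraus_map_def by (simp cong: mat_lincomb_cong)
qed

section \<open>Unitary matrices\<close>

lemma unitary_mat_carrier: "unitary_mat n U \<Longrightarrow> U \<in> carrier_mat n n"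
  by (simp add: unitary_mat_def)

lemma unitary_mat_isometry: "unitary_mat n U \<Longrightarrow> ctrans U * U = 1\<^sub>m n"
  by (simp add: unitary_mat_def)

lemma unitary_matI:
  assumes U: "U \<in> carrier_mat n n" and "ctrans U * U = 1\<^sub>m n"
  shows "unitary_mat n U"
  using assms mat_mult_left_right_inverse[of "ctrans U" n U] by (simp add: unitary_mat_def)

lemma unitary_mat_one: "unitary_mat n (1\<^sub>m n)"
  by (simp add: unitary_mat_def)

lemma unitary_mat_ctrans: "unitary_mat n U \<Longrightarrow> unitary_mat n (ctrans U)"
  by (simp add: unitary_mat_def)

lemma unitary_mat_mult:
  assumes U: "unitary_mat n U" and V: "unitary_mat n V"
  shows "unitary_mat n (U * V)"
proof (rule unitary_matI)
  note carrier = unitary_mat_carrier[OF U] unitary_mat_carrier[OF V]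
  have "ctrans (U * V) * (U * V) = ctrans V * (ctrans U * U) * V"
    using carrier by (simp add: ctrans_mult assoc_mult_mat_dim carrier_matD del: assoc_mult_mat)
  also have "\<dots> = 1\<^sub>m n" using carrier
    by (simp add: unitary_mat_isometry[OF U] unitary_mat_isometry[OF V])
  finally show "ctrans (U * V) * (U * V) = 1\<^sub>m n" .
qed (use unitary_mat_carrier[OF U] unitary_mat_carrier[OF V] in auto)

lemma opnorm_unitary_mat_le: "unitary_mat n U \<Longrightarrow> opnorm U \<le> 1"
  by (rule opnorm_isometry_le[OF unitary_mat_carrier unitary_mat_isometry])

lemma cmod_index_unitary_mat_le:
  assumes U: "unitary_mat n U" and "i < n" "j < n"
  shows "cmod (U $$ (i, j)) \<le> 1"
  using cmod_index_le_opnorm[OF unitary_mat_carrier[OF U], of i j] opnorm_unitary_mat_le[OF U] assms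
  by linarith

lemma unitary_mat_diag:
  assumes "\<And>i. i < n \<Longrightarrow> cmod (\<phi> i) = 1"
  shows "unitary_mat n (mat_diag n \<phi>)"
proof (rule unitary_matI)
  have "ctrans (mat_diag n \<phi>) = mat_diag n (\<lambda>i. cnj (\<phi> i))"
    by (rule eq_matI) (auto simp: mat_diag_def)
  moreover have "mat_diag n (\<lambda>i. cnj (\<phi> i) * \<phi> i) = 1\<^sub>m n"
  proof (rule eq_mat_dimI)
    fix i j assume ij: "i < n" "j < n"
    have "cnj (\<phi> i) * \<phi> i = 1"
      using complex_norm_square[of "\<phi> i"] assms[OF ij(1)] by (simp add: mult.commute)
    then show "mat_diag n (\<lambda>i. cnj (\<phi> i) * \<phi> i) $$ (i, j) = 1\<^sub>m n $$ (i, j)"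
      using ij by (auto simp: mat_diag_def)
  qed (simp_all add: mat_diag_def)
  ultimately show "ctrans (mat_diag n \<phi>) * mat_diag n \<phi> = 1\<^sub>m n" by simp
qed simp

definition outer_prod :: "complex vec \<Rightarrow> complex vec \<Rightarrow> complex mat" where
  "outer_prod v u = mat (dim_vec v) (dim_vec u) (\<lambda>(i, j). v $ i * cnj (u $ j))"

lemma outer_prod_carrier [simp]:
  "v \<in> carrier_vec r \<Longrightarrow> u \<in> carrier_vec c \<Longrightarrow> outer_prod v u \<in> carrier_mat r c"
  by (auto simp: outer_prod_def)

lemma ctrans_outer_prod: "ctrans (outer_prod v u) = outer_prod u v"
  by (rule eq_matI) (auto simp: outer_prod_def)

lemma outer_prod_self_mult_self: "outer_prod v v * outer_prod v v = (v \<bullet>c v) \<cdot>\<^sub>m outer_prod v v"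
proof (rule eq_mat_dimI)
  have P: "outer_prod v v \<in> carrier_mat (dim_vec v) (dim_vec v)" by (simp add: outer_prod_def)
  fix i j assume ij: "i < dim_vec v" "j < dim_vec v"
  then show "(outer_prod v v * outer_prod v v) $$ (i, j) = ((v \<bullet>c v) \<cdot>\<^sub>m outer_prod v v) $$ (i, j)"
    unfolding index_mult_mat_sum[OF P P ij] cscalar_prod_sum[OF carrier_vecI[OF refl]]
    by (simp add: outer_prod_def sum_distrib_right sum_distrib_left mult_ac)
qed (auto simp: outer_prod_def)

lemma unitary_mat_rank_one_perturbation:
  assumes v: "v \<in> carrier_vec n" and unimodular: "c + cnj c + c * cnj c * (v \<bullet>c v) = 0"
  shows "unitary_mat n (1\<^sub>m n + c \<cdot>\<^sub>m outer_prod v v)"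
proof (rule unitary_matI)
  let ?P = "outer_prod v v"
  have P: "?P \<in> carrier_mat n n" using v by simp
  have "ctrans (1\<^sub>m n + c \<cdot>\<^sub>m ?P) = 1\<^sub>m n + cnj c \<cdot>\<^sub>m ctrans ?P"
    using P by (intro eq_matI) auto
  then have "ctrans (1\<^sub>m n + c \<cdot>\<^sub>m ?P) * (1\<^sub>m n + c \<cdot>\<^sub>m ?P)
      = 1\<^sub>m n + cnj c \<cdot>\<^sub>m ?P + c \<cdot>\<^sub>m (?P + cnj c \<cdot>\<^sub>m (?P * ?P))"
    using P by (simp add: ctrans_outer_prod add_mult_distrib_mat[of _ n n]
        mult_add_distrib_mat[of _ n n _ n]
        mult_smult_assoc_mat[of _ n n _ n] mult_smult_distrib[of _ n n _ n])
  also have "\<dots> = 1\<^sub>m n + (c + cnj c + c * cnj c * (v \<bullet>c v)) \<cdot>\<^sub>m ?P"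
    unfolding outer_prod_self_mult_self using P by (intro eq_matI) (auto simp: algebra_simps)
  finally show "ctrans (1\<^sub>m n + c \<cdot>\<^sub>m ?P) * (1\<^sub>m n + c \<cdot>\<^sub>m ?P) = 1\<^sub>m n"
    using P unfolding unimodular by auto
qed (use v in auto)

section \<open>Positive semidefinite matrices\<close>

lemma psd_mat_iff:
  "psd_mat d A \<longleftrightarrow> A \<in> carrier_mat d d \<and>
    (\<forall>v\<in>carrier_vec d. Im ((A *\<^sub>v v) \<bullet>c v) = 0 \<and> 0 \<le> Re ((A *\<^sub>v v) \<bullet>c v))"
  by (auto simp: psd_mat_def cscalar_prod_sum mult.commute simp del: index_mult_mat_vec)

lemma cscalar_prod_mult_unit_vec:
  fixes A :: "complex mat"
  assumes A: "A \<in> carrier_mat r c" and ij: "i < r" "j < c"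
  shows "(A *\<^sub>v unit_vec c j) \<bullet>c unit_vec r i = A $$ (i, j)"
proof -
  have "(A *\<^sub>v unit_vec c j) \<bullet>c unit_vec r i = (\<Sum>k<r. if k = i then A $$ (k, j) else 0)"
    unfolding cscalar_prod_sum[OF unit_vec_carrier] using A ij by (intro sum.cong refl) auto
  then show ?thesis using ij by simp
qed

lemma psd_mat_diag_nonneg:
  assumes A: "psd_mat d A" and i: "i < d"
  shows "Im (A $$ (i, i)) = 0" "0 \<le> Re (A $$ (i, i))"
proof -
  have "A \<in> carrier_mat d d" using A by (simp add: psd_mat_iff)
  then show "Im (A $$ (i, i)) = 0" "0 \<le> Re (A $$ (i, i))"
    using A i cscalar_prod_mult_unit_vec[of A d d i i] unfolding psd_mat_iff
    by (metis unit_vec_carrier)+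
qed

lemma psd_mat_hermitian:
  assumes A: "psd_mat d A"
  shows "ctrans A = A"
proof (rule eq_mat_dimI)
  have carrier: "A \<in> carrier_mat d d" using A by (simp add: psd_mat_iff)
  then show "dim_row (ctrans A) = d" "dim_row A = d" "dim_col (ctrans A) = d" "dim_col A = d" by auto
  fix i j assume ij: "i < d" "j < d"
  have form: "Im (A $$ (i, i) + b * A $$ (i, j) + cnj b * A $$ (j, i) + b * cnj b * A $$ (j, j))
      = 0" for b
  proof -
    define e where "e l = (unit_vec d l :: complex vec)" for l
    have e: "e l \<in> carrier_vec d" for l by (simp add: e_def)
    have Ae: "A *\<^sub>v e l \<in> carrier_vec d" for l using carrier e by simp
    have "(A *\<^sub>v (e i + b \<cdot>\<^sub>v e j)) \<bullet>c (e i + b \<cdot>\<^sub>v e j)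
        = (A *\<^sub>v e i) \<bullet>c e i + b * ((A *\<^sub>v e j) \<bullet>c e i) + cnj b * ((A *\<^sub>v e i) \<bullet>c e j)
          + b * cnj b * ((A *\<^sub>v e j) \<bullet>c e j)"
      using carrier e Ae
      by (simp add: mult_add_distrib_mat_vec[of _ d d] mult_mat_vec[of _ d d]
          conjugate_add_vec[of _ d] conjugate_smult_vec
          add_scalar_prod_distrib[of _ d] scalar_prod_add_distrib[of _ d]
          carrier_matD[OF carrier] carrier_vecD[OF e] algebra_simps)
    moreover have "e i + b \<cdot>\<^sub>v e j \<in> carrier_vec d" using e by simp
    ultimately show ?thesis
      using A ij unfolding psd_mat_iff e_def by (metis carrier cscalar_prod_mult_unit_vec)
  qed
  have "Im (A $$ (i, j)) = - Im (A $$ (j, i))"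
    using form[of 1] psd_mat_diag_nonneg[OF A] ij by simp
  moreover have "Re (A $$ (i, j)) = Re (A $$ (j, i))"
    using form[of \<i>] psd_mat_diag_nonneg[OF A] ij by simp
  ultimately show "ctrans A $$ (i, j) = A $$ (i, j)"
    using carrier ij by (simp add: complex_eq_iff)
qed

lemma nonneg_if_rotations_le:
  assumes "\<And>w. cmod w = 1 \<Longrightarrow> Re ((w - 1) * h) \<le> 0"
  shows "Im h = 0 \<and> 0 \<le> Re h"
proof (cases "h = 0")
  case False
  define w where "w = cnj h / complex_of_real (cmod h)"
  have "cmod w = 1" using False by (simp add: w_def norm_divide)
  then have "Re ((w - 1) * h) \<le> 0" by (rule assms)
  moreover have "w * h = complex_of_real (cmod h)"
    using False complex_norm_square[of h] by (simp add: w_def power2_eq_square field_simps)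
  ultimately have "cmod h \<le> Re h" by (simp only: left_diff_distrib) simp
  then have "Re h = cmod h" using complex_Re_le_cmod[of h] by simp
  then show ?thesis using cmod_power2[of h] by simp
qed simp

lemma mtrace_mult_commute:
  assumes A: "A \<in> carrier_mat n m" and B: "B \<in> carrier_mat m n"
  shows "mtrace (A * B) = mtrace (B * A)"
proof -
  have "mtrace (A * B) = (\<Sum>i<n. \<Sum>k<m. A $$ (i, k) * B $$ (k, i))"
    using A B by (simp add: mtrace_def index_mult_mat_sum[OF A B] del: index_mult_mat(1))
  also have "\<dots> = (\<Sum>k<m. \<Sum>i<n. B $$ (k, i) * A $$ (i, k))"
    by (subst sum.swap) (simp add: mult.commute)
  also have "\<dots> = mtrace (B * A)"
    using A B by (simp add: mtrace_def index_mult_mat_sum[OF B A] del: index_mult_mat(1))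
  finally show ?thesis .
qed

lemma mtrace_add_smult:
  "A \<in> carrier_mat n n \<Longrightarrow> B \<in> carrier_mat n n \<Longrightarrow> mtrace (A + c \<cdot>\<^sub>m B) = mtrace A + c * mtrace B"
  by (auto simp: mtrace_def sum.distrib sum_distrib_left)

lemma mtrace_outer_prod_mult:
  assumes v: "v \<in> carrier_vec n" and A: "A \<in> carrier_mat n n"
  shows "mtrace (outer_prod v v * A) = (A *\<^sub>v v) \<bullet>c v"
proof -
  have P: "outer_prod v v \<in> carrier_mat n n" using v by simp
  have "(A * outer_prod v v) $$ (i, i) = (\<Sum>k<n. A $$ (i, k) * v $ k * cnj (v $ i))" if "i < n" for i
    unfolding index_mult_mat_sum[OF A P that that] using v that
    by (simp add: outer_prod_def mult.assoc)
  then have "mtrace (A * outer_prod v v) = (\<Sum>i<n. \<Sum>k<n. A $$ (i, k) * v $ k * cnj (v $ i))"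
    using A by (simp add: mtrace_def)
  also have "\<dots> = (A *\<^sub>v v) \<bullet>c v"
    by (simp add: cscalar_prod_sum[OF v] index_mult_mat_vec_sum[OF A v] sum_distrib_right
        del: index_mult_mat_vec)
  finally show ?thesis using mtrace_mult_commute[OF A P] by simp
qed

lemma mtrace_rank_one_perturbation_mult:
  assumes v: "v \<in> carrier_vec n" and A: "A \<in> carrier_mat n n"
  shows "mtrace ((1\<^sub>m n + c \<cdot>\<^sub>m outer_prod v v) * A) = mtrace A + c * ((A *\<^sub>v v) \<bullet>c v)"
proof -
  have P: "outer_prod v v \<in> carrier_mat n n" using v by simp
  have "(1\<^sub>m n + c \<cdot>\<^sub>m outer_prod v v) * A = A + c \<cdot>\<^sub>m (outer_prod v v * A)"
    using A P by (simp add: add_mult_distrib_mat[of _ n n] mult_smult_assoc_mat[of _ n n])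
  then show ?thesis
    using mtrace_add_smult[OF A mult_carrier_mat[OF P A], of c] mtrace_outer_prod_mult[OF v A]
    by simp
qed

text \<open>The test unitaries multiply the line of a given vector by a phase and fix its orthogonal
  complement.\<close>

lemma psd_mat_if_trace_maximal:
  assumes A: "A \<in> carrier_mat n n"
    and maximal: "\<And>U. unitary_mat n U \<Longrightarrow> Re (mtrace (U * A)) \<le> Re (mtrace A)"
  shows "psd_mat n A"
  unfolding psd_mat_iff
proof (intro conjI ballI A)
  fix v :: "complex vec" assume v: "v \<in> carrier_vec n"
  let ?h = "(A *\<^sub>v v) \<bullet>c v"
  have "Im ?h = 0 \<and> 0 \<le> Re ?h"
  proof (cases "v = 0\<^sub>v n")
    case True
    then have "A *\<^sub>v v = 0\<^sub>v n" using A by auto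
    then show ?thesis using v by simp
  next
    case False
    define s where "s = (vnorm v)\<^sup>2"
    have s: "s > 0" and vv: "v \<bullet>c v = complex_of_real s"
      using False vnorm_eq_0_iff[OF v] cscalar_prod_self[of v] by (simp_all add: s_def)
    show ?thesis
    proof (rule nonneg_if_rotations_le)
      fix w :: complex assume w: "cmod w = 1"
      define c where "c = (w - 1) / complex_of_real s"
      have "w * cnj w = 1" using complex_norm_square[of w] w by simp
      then have "c + cnj c + c * cnj c * (v \<bullet>c v) = 0"
        using s unfolding vv c_def by (simp add: field_simps)
      from maximal[OF unitary_mat_rank_one_perturbation[OF v this]]
      have "Re (c * ?h) \<le> 0" unfolding mtrace_rank_one_perturbation_mult[OF v A] by simp
      moreover have "Re (c * ?h) = Re ((w - 1) * ?h) / s"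
        unfolding c_def by (metis Re_divide_of_real times_divide_eq_left)
      ultimately show "Re ((w - 1) * ?h) \<le> 0" using s by (metis divide_le_0_iff not_le)
    qed
  qed
  then show "Im ?h = 0" "0 \<le> Re ?h" by auto
qed

section \<open>Compactness of the unitary group\<close>

definition mat_LIMSEQ :: "nat \<Rightarrow> (nat \<Rightarrow> complex mat) \<Rightarrow> complex mat \<Rightarrow> bool" where
  "mat_LIMSEQ n X L \<longleftrightarrow> (\<forall>i<n. \<forall>j<n. (\<lambda>k. X k $$ (i, j)) \<longlonglongrightarrow> L $$ (i, j))"

lemma mat_LIMSEQ_const: "mat_LIMSEQ n (\<lambda>_. A) A"
  by (simp add: mat_LIMSEQ_def)

lemma mat_LIMSEQ_mult:
  assumes "mat_LIMSEQ n X A" "mat_LIMSEQ n Y B"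
    and X: "\<And>k. X k \<in> carrier_mat n n" and Y: "\<And>k. Y k \<in> carrier_mat n n"
    and A: "A \<in> carrier_mat n n" and B: "B \<in> carrier_mat n n"
  shows "mat_LIMSEQ n (\<lambda>k. X k * Y k) (A * B)"
  unfolding mat_LIMSEQ_def
proof (intro allI impI)
  fix i j assume ij: "i < n" "j < n"
  show "(\<lambda>k. (X k * Y k) $$ (i, j)) \<longlonglongrightarrow> (A * B) $$ (i, j)"
    unfolding index_mult_mat_sum[OF X Y ij] index_mult_mat_sum[OF A B ij]
    using assms(1,2) ij by (intro tendsto_sum tendsto_mult) (auto simp: mat_LIMSEQ_def)
qed

lemma mat_LIMSEQ_ctrans:
  assumes "mat_LIMSEQ n X A" "\<And>k. X k \<in> carrier_mat n n" "A \<in> carrier_mat n n"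
  shows "mat_LIMSEQ n (\<lambda>k. ctrans (X k)) (ctrans A)"
proof -
  have "ctrans (X k) $$ (i, j) = cnj (X k $$ (j, i))" if "i < n" "j < n" for i j k
    using assms(2)[of k] that by auto
  then show ?thesis using assms(1,3) by (auto simp: mat_LIMSEQ_def intro!: tendsto_cnj)
qed

lemma mat_LIMSEQ_subseq: "mat_LIMSEQ n X A \<Longrightarrow> strict_mono r \<Longrightarrow> mat_LIMSEQ n (\<lambda>k. X (r k)) A"
  using LIMSEQ_subseq_LIMSEQ by (fastforce simp: mat_LIMSEQ_def o_def)

lemma mat_LIMSEQ_unique:
  assumes "mat_LIMSEQ n X A" "mat_LIMSEQ n X B" "A \<in> carrier_mat n n" "B \<in> carrier_mat n n"
  shows "A = B"
proof (rule eq_mat_dimI)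
  fix i j assume "i < n" "j < n"
  then show "A $$ (i, j) = B $$ (i, j)"
    using assms unfolding mat_LIMSEQ_def by (intro LIMSEQ_unique[of "\<lambda>k. X k $$ (i, j)"]) auto
qed (use assms in auto)

lemma tendsto_mtrace:
  assumes "mat_LIMSEQ n X A" "\<And>k. X k \<in> carrier_mat n n" "A \<in> carrier_mat n n"
  shows "(\<lambda>k. mtrace (X k)) \<longlonglongrightarrow> mtrace A"
proof -
  have "mtrace (X k) = (\<Sum>i<n. X k $$ (i, i))" for k
    using assms(2)[of k] by (auto simp: mtrace_def)
  then show ?thesis using assms(1,3) by (auto simp: mtrace_def mat_LIMSEQ_def intro!: tendsto_sum)
qed

lemma unitary_mat_LIMSEQ:
  assumes U: "\<And>k. unitary_mat n (U k)" and lim: "mat_LIMSEQ n U V" and V: "V \<in> carrier_mat n n"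
  shows "unitary_mat n V"
proof (rule unitary_matI[OF V])
  have "mat_LIMSEQ n (\<lambda>k. ctrans (U k) * U k) (ctrans V * V)"
    using lim V unitary_mat_carrier[OF U] by (intro mat_LIMSEQ_mult mat_LIMSEQ_ctrans) auto
  then show "ctrans V * V = 1\<^sub>m n"
    using V unfolding unitary_mat_isometry[OF U]
    by (intro mat_LIMSEQ_unique[OF _ mat_LIMSEQ_const]) auto
qed

lemma bounded_family_convergent_subseq:
  fixes f :: "nat \<Rightarrow> 'i \<Rightarrow> 'a::heine_borel"
  assumes I: "finite I" and bounded_range: "\<And>i. i \<in> I \<Longrightarrow> bounded (range (\<lambda>j. f j i))"
  shows "\<exists>r g. strict_mono r \<and> (\<forall>i\<in>I. (\<lambda>j. f (r j) i) \<longlonglongrightarrow> g i)"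
proof -
  have "\<forall>I'\<subseteq>I. \<exists>g r. strict_mono r \<and>
      (\<forall>\<epsilon>>0. \<forall>\<^sub>F j in sequentially. \<forall>i\<in>I'. dist (f (r j) i) (g i) < \<epsilon>)"
    using compact_lemma_general[OF I, of "\<lambda>x i. x i" f "\<lambda>x. x"] bounded_range
    by (simp add: image_image)
  then obtain g r where "strict_mono r"
    and lim: "\<forall>\<epsilon>>0. \<forall>\<^sub>F j in sequentially. \<forall>i\<in>I. dist (f (r j) i) (g i) < \<epsilon>" by blast
  moreover have "(\<lambda>j. f (r j) i) \<longlonglongrightarrow> g i" if "i \<in> I" for i
    using lim that by (auto simp: tendsto_iff elim!: eventually_mono)
  ultimately show ?thesis by blast
qed

lemma unitary_family_convergent_subseq:
  fixes U :: "nat \<Rightarrow> 'l \<Rightarrow> complex mat"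
  assumes L: "finite L" and U: "\<And>l k. l \<in> L \<Longrightarrow> unitary_mat n (U k l)"
  shows "\<exists>r V. strict_mono r \<and> (\<forall>l\<in>L. unitary_mat n (V l) \<and> mat_LIMSEQ n (\<lambda>k. U (r k) l) (V l))"
proof -
  define f where "f k = (\<lambda>(l, ij). (Re (U k l $$ ij), Im (U k l $$ ij)))" for k
  define I where "I = L \<times> {..<n} \<times> {..<n}"
  have "bounded (range (\<lambda>k. f k i))" if "i \<in> I" for i
  proof (rule boundedI)
    obtain l a b where i: "i = (l, a, b)" "l \<in> L" "a < n" "b < n" using \<open>i \<in> I\<close> unfolding I_def
      by blast
    fix x assume "x \<in> range (\<lambda>k. f k i)"
    then obtain k where "x = f k i" by blast
    then have "norm x = cmod (U k l $$ (a, b))" by (simp add: f_def i norm_prod_def cmod_def)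
    then show "norm x \<le> 1" using cmod_index_unitary_mat_le[OF U[OF i(2)] i(3,4)] by simp
  qed
  moreover have "finite I" using L by (simp add: I_def)
  ultimately obtain r g where r: "strict_mono r" and f_lim: "\<And>i. i \<in> I \<Longrightarrow> (\<lambda>k. f (r k) i) \<longlonglongrightarrow> g i"
    using bounded_family_convergent_subseq[of I f] by blast
  define V where "V l = mat n n (\<lambda>ij. Complex (fst (g (l, ij))) (snd (g (l, ij))))" for l
  have V: "V l \<in> carrier_mat n n" for l by (simp add: V_def)
  have lim: "mat_LIMSEQ n (\<lambda>k. U (r k) l) (V l)" if "l \<in> L" for l
    unfolding mat_LIMSEQ_def
  proof (intro allI impI)
    fix a b assume ab: "a < n" "b < n"
    have "(\<lambda>k. Complex (fst (f (r k) (l, a, b))) (snd (f (r k) (l, a, b)))) \<longlonglongrightarrow> V l $$ (a, b)"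
      using f_lim[of "(l, a, b)"] that ab
      by (auto simp: V_def I_def intro!: tendsto_Complex tendsto_fst tendsto_snd)
    then show "(\<lambda>k. U (r k) l $$ (a, b)) \<longlonglongrightarrow> V l $$ (a, b)" by (simp add: f_def)
  qed
  then show ?thesis using r unitary_mat_LIMSEQ[OF U lim V] by blast
qed

section \<open>Singular value decomposition and contractions\<close>

lemma weighted_trace_maximizer_exists:
  assumes D: "D \<in> carrier_mat n n" and A: "A \<in> carrier_mat n n"
  shows "\<exists>P Q. unitary_mat n P \<and> unitary_mat n Q \<and>
    (\<forall>P' Q'. unitary_mat n P' \<longrightarrow> unitary_mat n Q' \<longrightarrow>
      Re (mtrace (D * (P' * A * Q'))) \<le> Re (mtrace (D * (P * A * Q))))"
proof -
  define F where "F P Q = Re (mtrace (D * (P * A * Q)))" for P Q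
  define S where "S = {F P Q | P Q. unitary_mat n P \<and> unitary_mat n Q}"
  have "seq_compact S"
    unfolding seq_compact_def
  proof (intro allI impI)
    fix s :: "nat \<Rightarrow> real" assume "\<forall>k. s k \<in> S"
    then have "\<forall>k. \<exists>P Q. s k = F P Q \<and> unitary_mat n P \<and> unitary_mat n Q" by (auto simp: S_def)
    then obtain P Q where s: "\<And>k. s k = F (P k) (Q k)"
      and PQ: "\<And>k. unitary_mat n (P k)" "\<And>k. unitary_mat n (Q k)" by metis
    have "\<exists>r V. strict_mono r \<and> (\<forall>b\<in>UNIV. unitary_mat n (V b) \<and>
        mat_LIMSEQ n (\<lambda>k. if b then P (r k) else Q (r k)) (V b))"
      using PQ by (intro unitary_family_convergent_subseq) auto
    then obtain r V where r: "strict_mono r" and V: "\<And>b. unitary_mat n (V b)"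
      and lim: "\<And>b. mat_LIMSEQ n (\<lambda>k. if b then P (r k) else Q (r k)) (V b)" by blast
    note lim_PQ = lim[of True, simplified] lim[of False, simplified]
    note carriers = A D PQ[THEN unitary_mat_carrier] V[THEN unitary_mat_carrier]
      mult_carrier_mat[of _ n n _ n]
    have "mat_LIMSEQ n (\<lambda>k. D * (P (r k) * A * Q (r k))) (D * (V True * A * V False))"
      by (intro mat_LIMSEQ_mult mat_LIMSEQ_const lim_PQ carriers)
    then have "(\<lambda>k. s (r k)) \<longlonglongrightarrow> F (V True) (V False)"
      unfolding s F_def by (intro tendsto_Re tendsto_mtrace[of n] carriers)
    moreover have "F (V True) (V False) \<in> S" using V by (auto simp: S_def)
    ultimately show "\<exists>l\<in>S. \<exists>r. strict_mono r \<and> (s \<circ> r) \<longlonglongrightarrow> l" using r by (auto simp: o_def)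
  qed
  then have "compact S" by (simp add: compact_eq_seq_compact_metric)
  moreover have "S \<noteq> {}" using unitary_mat_one unfolding S_def by blast
  ultimately obtain m where "m \<in> S" "\<forall>t\<in>S. t \<le> m" using compact_attains_sup[of S] by blast
  then show ?thesis unfolding S_def F_def by blast
qed

text \<open>M D and D M are Hermitian, so the (i,j) entry m of M satisfies d_i^2 m = d_j^2 m.\<close>

lemma mat_eq_diag_if_psd_mult_diag:
  fixes d :: "nat \<Rightarrow> real" and n :: nat
  defines "D \<equiv> mat_diag n (\<lambda>i. complex_of_real (d i))"
  assumes M: "M \<in> carrier_mat n n" and MD: "psd_mat n (M * D)" and DM: "psd_mat n (D * M)"
    and d_pos: "\<And>i. i < n \<Longrightarrow> 0 < d i" and d_inj: "inj_on d {..<n}"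
  shows "\<exists>\<sigma>. (\<forall>i<n. 0 \<le> \<sigma> i) \<and> M = mat_diag n (\<lambda>i. complex_of_real (\<sigma> i))"
proof (intro exI conjI allI impI)
  have MD_entry: "(M * D) $$ (i, j) = M $$ (i, j) * d j"
    and DM_entry: "(D * M) $$ (i, j) = d i * M $$ (i, j)"
    if "i < n" "j < n" for i j
    using that by (simp_all add: D_def mat_diag_mult_right[OF M] mat_diag_mult_left[OF M])
  have D: "D \<in> carrier_mat n n" by (simp add: D_def)
  have hermitian: "N $$ (i, j) = cnj (N $$ (j, i))" if "psd_mat n N" "i < n" "j < n" for N i j
    using psd_mat_hermitian[OF that(1)] that by (metis carrier_matD index_ctrans psd_mat_iff)
  have off_diag: "M $$ (i, j) = 0" if ij: "i < n" "j < n" "i \<noteq> j" for i j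
  proof -
    have left: "M $$ (i, j) * d j = d i * cnj (M $$ (j, i))"
      using hermitian[OF MD ij(1,2)] ij by (simp add: MD_entry mult.commute)
    have right: "d i * M $$ (i, j) = d j * cnj (M $$ (j, i))"
      using hermitian[OF DM ij(1,2)] ij by (simp add: DM_entry)
    have "d i * (d i * M $$ (i, j)) = d j * (M $$ (i, j) * d j)"
      unfolding left right by (simp only: mult.left_commute)
    then have "complex_of_real ((d i)\<^sup>2 - (d j)\<^sup>2) * M $$ (i, j) = 0"
      by (simp add: algebra_simps power2_eq_square)
    moreover have "(d i)\<^sup>2 \<noteq> (d j)\<^sup>2"
      using d_pos[OF ij(1)] d_pos[OF ij(2)] inj_onD[OF d_inj, of i j] ij
      by (auto simp: power2_eq_iff)
    ultimately show ?thesis by (metis eq_iff_diff_eq_0 mult_eq_0_iff of_real_eq_0_iff)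
  qed
  have diag: "Im (M $$ (i, i)) = 0" "0 \<le> Re (M $$ (i, i))" if "i < n" for i
    using psd_mat_diag_nonneg[OF MD that] d_pos[OF that]
    by (simp_all add: MD_entry that zero_le_mult_iff)
  show "0 \<le> Re (M $$ (i, i))" if "i < n" for i by (rule diag(2)[OF that])
  show "M = mat_diag n (\<lambda>i. complex_of_real (Re (M $$ (i, i))))"
    by (rule eq_matI) (use M off_diag diag in \<open>auto simp: mat_diag_def complex_eq_iff\<close>)
qed

lemma unitary_mat_mult_mult_cancel:
  assumes P: "unitary_mat n P" and Q: "unitary_mat n Q" and A: "A \<in> carrier_mat n n"
  shows "ctrans P * (P * A * Q) * ctrans Q = A"
proof -
  have "ctrans P * (P * A * Q) * ctrans Q = (ctrans P * P) * A * (Q * ctrans Q)"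
    using A unitary_mat_carrier[OF P] unitary_mat_carrier[OF Q]
    by (simp add: assoc_mult_mat[of _ n n _ n _ n])
  also have "\<dots> = A" using P Q A by (simp add: unitary_mat_def)
  finally show ?thesis .
qed

text \<open>At a maximizer of the real part of the trace of D P A Q over pairs of unitaries, with
  D = diag(1, ..., n), both M D and D M are positive semidefinite for M = P A Q.\<close>

lemma singular_value_decomposition:
  assumes A: "A \<in> carrier_mat n n"
  shows "\<exists>P Q \<sigma>. unitary_mat n P \<and> unitary_mat n Q \<and> (\<forall>i<n. 0 \<le> \<sigma> i) \<and>
    A = P * mat_diag n (\<lambda>i. complex_of_real (\<sigma> i)) * Q"
proof -
  define D where "D = mat_diag n (\<lambda>i. complex_of_real (real (Suc i)))"
  have D: "D \<in> carrier_mat n n" by (simp add: D_def)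
  obtain P Q where P: "unitary_mat n P" and Q: "unitary_mat n Q"
    and maximal: "\<And>P' Q'. unitary_mat n P' \<Longrightarrow> unitary_mat n Q' \<Longrightarrow>
      Re (mtrace (D * (P' * A * Q'))) \<le> Re (mtrace (D * (P * A * Q)))"
    using weighted_trace_maximizer_exists[OF D A] by blast
  define M where "M = P * A * Q"
  note carriers = A D unitary_mat_carrier[OF P] unitary_mat_carrier[OF Q]
  have M: "M \<in> carrier_mat n n" using carriers by (simp add: M_def)
  have "psd_mat n (M * D)"
  proof (rule psd_mat_if_trace_maximal)
    fix U assume U: "unitary_mat n U"
    note Uc = unitary_mat_carrier[OF U]
    have "mtrace (U * (M * D)) = mtrace (D * (U * P * A * Q))"
      using mtrace_mult_commute[of "U * M" n n D] carriers Uc M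
      by (simp add: M_def assoc_mult_mat[of _ n n _ n _ n])
    then show "Re (mtrace (U * (M * D))) \<le> Re (mtrace (M * D))"
      using maximal[OF unitary_mat_mult[OF U P] Q] mtrace_mult_commute[OF M D] by (simp add: M_def)
  qed (use M D in auto)
  moreover have "psd_mat n (D * M)"
  proof (rule psd_mat_if_trace_maximal)
    fix U assume U: "unitary_mat n U"
    note Uc = unitary_mat_carrier[OF U]
    have "mtrace (U * (D * M)) = mtrace (D * (P * A * (Q * U)))"
      using mtrace_mult_commute[OF Uc, of "D * M"] carriers Uc M
      by (simp add: M_def assoc_mult_mat[of _ n n _ n _ n])
    then show "Re (mtrace (U * (D * M))) \<le> Re (mtrace (D * M))"
      using maximal[OF P unitary_mat_mult[OF Q U]] by (simp add: M_def)
  qed (use M D in auto)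
  ultimately obtain \<sigma> where \<sigma>: "\<forall>i<n. 0 \<le> \<sigma> i" "M = mat_diag n (\<lambda>i. complex_of_real (\<sigma> i))"
    using mat_eq_diag_if_psd_mult_diag[OF M, of "\<lambda>i. real (Suc i)"] unfolding D_def
    by (auto simp: inj_on_def)
  have "A = ctrans P * M * ctrans Q" unfolding M_def
    by (rule unitary_mat_mult_mult_cancel[OF P Q A, symmetric])
  then show ?thesis using \<sigma> unitary_mat_ctrans[OF P] unitary_mat_ctrans[OF Q] by blast
qed

lemma singular_value_le_opnorm:
  assumes P: "unitary_mat n P" and Q: "unitary_mat n Q" and i: "i < n"
  shows "cmod (\<sigma> i) \<le> opnorm (P * mat_diag n \<sigma> * Q)"
proof -
  let ?A = "P * mat_diag n \<sigma> * Q"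
  note P' = unitary_mat_ctrans[OF P] and Q' = unitary_mat_ctrans[OF Q]
  have A: "?A \<in> carrier_mat n n"
    using unitary_mat_carrier[OF P] unitary_mat_carrier[OF Q]
    by (intro mult_mult_carrier_mat[of _ n n]) auto
  have "cmod (\<sigma> i) = cmod (mat_diag n \<sigma> $$ (i, i))" using i by (simp add: mat_diag_def)
  also have "\<dots> \<le> opnorm (mat_diag n \<sigma>)" by (rule cmod_index_le_opnorm[OF mat_diag_dim i i])
  also have "mat_diag n \<sigma> = ctrans P * ?A * ctrans Q"
    by (rule unitary_mat_mult_mult_cancel[OF P Q mat_diag_dim, symmetric])
  also have "opnorm \<dots> \<le> opnorm ?A"
    by (rule opnorm_mult_mult_contraction_le[OF unitary_mat_carrier[OF P'] opnorm_unitary_mat_le[OF P']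
        A unitary_mat_carrier[OF Q'] opnorm_unitary_mat_le[OF Q']])
  finally show ?thesis .
qed

lemma contraction_eq_mean_unitary:
  assumes A: "A \<in> carrier_mat n n" and contraction: "opnorm A \<le> 1"
  shows "\<exists>B\<in>carrier_mat n n. unitary_mat n (A + \<i> \<cdot>\<^sub>m B) \<and> unitary_mat n (A + (- \<i>) \<cdot>\<^sub>m B)"
proof -
  obtain P Q \<sigma> where P: "unitary_mat n P" and Q: "unitary_mat n Q" and \<sigma>: "\<And>i. i < n \<Longrightarrow> 0 \<le> \<sigma> i"
    and A_eq: "A = P * mat_diag n (\<lambda>i. complex_of_real (\<sigma> i)) * Q"
    using singular_value_decomposition[OF A] by blast
  note carrier = unitary_mat_carrier[OF P] unitary_mat_carrier[OF Q]
  define s where "s i = sqrt (1 - (\<sigma> i)\<^sup>2)" for i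
  define B where "B = P * mat_diag n (\<lambda>i. complex_of_real (s i)) * Q"
  have "\<sigma> i \<le> 1" if "i < n" for i
    using singular_value_le_opnorm[OF P Q that, of "\<lambda>i. complex_of_real (\<sigma> i)"] contraction
    by (simp add: A_eq del: assoc_mult_mat)
  then have circle: "(\<sigma> i)\<^sup>2 + (s i)\<^sup>2 = 1" if "i < n" for i
    using \<sigma>[OF that] that by (simp add: s_def power_le_one)
  have "unitary_mat n (A + z \<cdot>\<^sub>m B)" if z: "z = \<i> \<or> z = - \<i>" for z
  proof -
    have "mat_diag n (\<lambda>i. \<sigma> i + z * s i)
        = 1 \<cdot>\<^sub>m mat_diag n (\<lambda>i. complex_of_real (\<sigma> i))
          + z \<cdot>\<^sub>m mat_diag n (\<lambda>i. complex_of_real (s i))"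
      by (rule eq_matI) (auto simp: mat_diag_def)
    then have "P * mat_diag n (\<lambda>i. \<sigma> i + z * s i) * Q = 1 \<cdot>\<^sub>m A + z \<cdot>\<^sub>m B"
      unfolding A_eq B_def
      by (simp only: mult_add_smult_mult_mat[OF carrier(1) mat_diag_dim mat_diag_dim carrier(2)])
    moreover have "cmod (\<sigma> i + z * s i) = 1" if "i < n" for i
      using circle[OF that] z by (auto simp: cmod_def)
    then have "unitary_mat n (P * mat_diag n (\<lambda>i. \<sigma> i + z * s i) * Q)"
      by (intro unitary_mat_mult P Q unitary_mat_diag)
    ultimately show ?thesis by (simp add: one_smult_mat)
  qed
  moreover have "B \<in> carrier_mat n n"
    unfolding B_def by (rule mult_mult_carrier_mat[OF carrier(1) mat_diag_dim carrier(2)])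
  ultimately show ?thesis by blast
qed

lemma parallelogram_conjugation:
  assumes A: "A \<in> carrier_mat n n" and B: "B \<in> carrier_mat n n" and x: "x \<in> carrier_mat n n"
    and ij: "i < n" "j < n"
  shows "(ctrans (A + \<i> \<cdot>\<^sub>m B) * x * (A + \<i> \<cdot>\<^sub>m B)) $$ (i, j)
      + (ctrans (A + (- \<i>) \<cdot>\<^sub>m B) * x * (A + (- \<i>) \<cdot>\<^sub>m B)) $$ (i, j)
    = 2 * ((ctrans A * x * A) $$ (i, j) + (ctrans B * x * B) $$ (i, j))"
proof -
  have conj_entry: "(ctrans C * x * C) $$ (i, j)
      = (\<Sum>p<n. \<Sum>q<n. cnj (C $$ (p, i)) * x $$ (p, q) * C $$ (q, j))"
    if "C \<in> carrier_mat n n" for C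
    using index_mult_mult_mat_sum[of "ctrans C" n n x n C n i j] that x ij
    by (simp del: assoc_mult_mat)
  have "A + z \<cdot>\<^sub>m B \<in> carrier_mat n n" for z using A B by simp
  then show ?thesis
    using A B ij unfolding conj_entry[OF A] conj_entry[OF B]
    by (subst (1 2) conj_entry)
      (auto simp: sum_distrib_left algebra_simps simp flip: sum.distrib intro!: sum.cong)
qed

section \<open>Convex combinations of automorphisms\<close>

lemma kraus_map_altdef:
  "kraus_map d L lam U
    = (\<lambda>x. mat d d (\<lambda>ij. \<Sum>l\<in>L. complex_of_real (lam l) * (ctrans (U l) * x * U l) $$ ij))"
  by (simp add: fun_eq_iff kraus_map_def mat_lincomb_def)

lemma conv_autE:
  assumes "R \<in> conv_aut d"
  obtains N :: nat and lam U where "\<And>l. l < N \<Longrightarrow> 0 \<le> lam l" "\<And>l. l < N \<Longrightarrow> unitary_mat d (U l)"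
    "(\<Sum>l<N. lam l) = 1" "R = kraus_map d {..<N} lam U"
  using assms unfolding conv_aut_def kraus_map_altdef by blast

lemma kraus_map_in_conv_aut:
  assumes L: "finite L" and lam: "\<And>l. l \<in> L \<Longrightarrow> 0 \<le> lam l" "(\<Sum>l\<in>L. lam l) = 1"
    and U: "\<And>l. l \<in> L \<Longrightarrow> unitary_mat d (U l)"
  shows "kraus_map d L lam U \<in> conv_aut d"
proof -
  obtain h where h: "bij_betw h {..<card L} L"
    using ex_bij_betw_nat_finite[OF L] unfolding atLeast0LessThan by blast
  have hL: "h l \<in> L" if "l < card L" for l using h that by (auto simp: bij_betw_def)
  have "(\<Sum>l<card L. complex_of_real (lam (h l)) * (ctrans (U (h l)) * x * U (h l)) $$ ij)
      = (\<Sum>l\<in>L. complex_of_real (lam l) * (ctrans (U l) * x * U l) $$ ij)" for x ij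
    by (rule sum.reindex_bij_betw[OF h])
  then have "kraus_map d L lam U = kraus_map d {..<card L} (\<lambda>l. lam (h l)) (\<lambda>l. U (h l))"
    unfolding kraus_map_altdef by (simp only:)
  moreover have "(\<Sum>l<card L. lam (h l)) = 1"
    using lam(2) sum.reindex_bij_betw[OF h, of lam] by simp
  ultimately show ?thesis
    unfolding conv_aut_def mem_Collect_eq kraus_map_altdef using lam(1) U hL
    by (intro exI[of _ "card L"] exI[of _ "\<lambda>l. lam (h l)"] exI[of _ "\<lambda>l. U (h l)"]) simp
qed

lemma linear_on_conv_aut: "R \<in> conv_aut d \<Longrightarrow> linear_on d R"
  by (elim conv_autE) (auto intro!: linear_on_kraus_map unitary_mat_carrier)

lemma conv_aut_nonempty: "conv_aut d \<noteq> {}"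
  using kraus_map_in_conv_aut[of "{()}" "\<lambda>_. 1" d "\<lambda>_. 1\<^sub>m d"] unitary_mat_one by auto

lemma kraus_map_unitary_mat_one:
  assumes "\<And>l. l \<in> L \<Longrightarrow> unitary_mat d (U l)"
  shows "kraus_map d L lam U (1\<^sub>m d) = complex_of_real (\<Sum>l\<in>L. lam l) \<cdot>\<^sub>m 1\<^sub>m d"
proof -
  have "ctrans (U l) * 1\<^sub>m d * U l = 1\<^sub>m d" if "l \<in> L" for l
    using assms[OF that] unitary_mat_carrier[OF assms[OF that]] by (simp add: unitary_mat_def)
  then have "kraus_map d L lam U (1\<^sub>m d)
      = mat_lincomb d L (\<lambda>l. complex_of_real (lam l)) (\<lambda>_. 1\<^sub>m d)"
    unfolding kraus_map_def by (intro mat_lincomb_cong refl)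
  also have "\<dots> = complex_of_real (\<Sum>l\<in>L. lam l) \<cdot>\<^sub>m 1\<^sub>m d"
    by (rule eq_matI) (auto simp: sum_distrib_right)
  finally show ?thesis .
qed

lemma conv_aut_one:
  assumes "R \<in> conv_aut d"
  shows "R (1\<^sub>m d) = 1\<^sub>m d"
  using assms
proof (rule conv_autE)
  fix N :: nat and lam U
  assume "\<And>l. l < N \<Longrightarrow> unitary_mat d (U l)" "(\<Sum>l<N. lam l) = 1" "R = kraus_map d {..<N} lam U"
  then show "R (1\<^sub>m d) = 1\<^sub>m d"
    using kraus_map_unitary_mat_one[of "{..<N}" d U lam]
    by (simp add: one_smult_mat del: of_real_sum)
qed

lemma kernel_nontrivial_if_zero_row:
  fixes A :: "'a::field mat"
  assumes A: "A \<in> carrier_mat n n" and i: "i < n" "row A i = 0\<^sub>v n"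
  shows "\<exists>v\<in>carrier_vec n. v \<noteq> 0\<^sub>v n \<and> A *\<^sub>v v = 0\<^sub>v n"
proof -
  have "A $$ (i, j) = 0" if "j < n" for j
    using A i that by (metis carrier_matD index_row(1) index_zero_vec(1))
  then have "transpose_mat A *\<^sub>v unit_vec n i = 0\<^sub>v n"
    using A i(1) by (intro eq_vecI) auto
  moreover have "unit_vec n i \<noteq> (0\<^sub>v n :: 'a vec)" using i by simp
  moreover have "transpose_mat A \<in> carrier_mat n n" using A by simp
  ultimately have "det (transpose_mat A) = 0"
    using det_0_iff_vec_prod_zero unit_vec_carrier by blast
  then show ?thesis using det_0_iff_vec_prod_zero[OF A] by (auto simp: det_transpose[OF A])
qed

lemma nontrivial_linear_relation:
  fixes y :: "'l \<Rightarrow> 'i \<Rightarrow> 'a::field"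
  assumes I: "finite I" and L: "finite L" and card: "card I < card L"
  shows "\<exists>c. (\<exists>l\<in>L. c l \<noteq> 0) \<and> (\<forall>i\<in>I. (\<Sum>l\<in>L. c l * y l i) = 0)"
proof -
  define n where "n = card L"
  obtain g where g: "bij_betw g {..<card I} I"
    using ex_bij_betw_nat_finite[OF I] unfolding atLeast0LessThan by blast
  obtain h where h: "bij_betw h L {..<n}"
    using ex_bij_betw_finite_nat[OF L] unfolding atLeast0LessThan n_def by blast
  define k where "k = inv_into L h"
  have k: "bij_betw k {..<n} L" unfolding k_def by (rule bij_betw_inv_into[OF h])
  define A where "A = mat n n (\<lambda>(a, b). if a < card I then y (k b) (g a) else 0)"
  have A: "A \<in> carrier_mat n n" by (simp add: A_def)
  have "row A (n - 1) = 0\<^sub>v n" using card by (intro eq_vecI) (auto simp: A_def n_def)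
  then obtain v where v: "v \<in> carrier_vec n" "v \<noteq> 0\<^sub>v n" "A *\<^sub>v v = 0\<^sub>v n"
    using kernel_nontrivial_if_zero_row[OF A, of "n - 1"] card by (auto simp: n_def)
  have "(\<Sum>l\<in>L. v $ h l * y l i) = 0" if i: "i \<in> I" for i
  proof -
    have "i \<in> g ` {..<card I}" using i g by (simp add: bij_betw_def)
    then obtain a where a: "a < card I" "i = g a" by blast
    then have an: "a < n" using card by (simp add: n_def)
    have "(\<Sum>l\<in>L. v $ h l * y l i) = (\<Sum>b<n. v $ h (k b) * y (k b) i)"
      by (rule sum.reindex_bij_betw[OF k, symmetric])
    also have "\<dots> = (\<Sum>b<n. A $$ (a, b) * v $ b)"
      using an a bij_betw_inv_into_right[OF h]
      by (intro sum.cong refl) (simp add: A_def k_def mult.commute)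
    also have "\<dots> = (A *\<^sub>v v) $ a" by (rule index_mult_mat_vec_sum[OF A v(1) an, symmetric])
    finally show ?thesis using an by (simp add: v(3))
  qed
  moreover have "\<exists>l\<in>L. v $ h l \<noteq> 0"
  proof -
    obtain b where "b < n" "v $ b \<noteq> 0" using v(1,2) by (auto simp: vec_eq_iff)
    moreover from this have "b \<in> h ` L" using h by (simp add: bij_betw_def)
    ultimately show ?thesis by blast
  qed
  ultimately show ?thesis by (intro exI[of _ "\<lambda>l. v $ h l"]) blast
qed

lemma conic_combination_remove:
  fixes y :: "'l \<Rightarrow> 'i \<Rightarrow> real"
  assumes I: "finite I" and L: "finite L" and card: "card I < card L"
    and lam: "\<And>l. l \<in> L \<Longrightarrow> 0 \<le> lam l"
  shows "\<exists>k\<in>L. \<exists>mu. (\<forall>l\<in>L - {k}. 0 \<le> mu l) \<and>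
    (\<forall>i\<in>I. (\<Sum>l\<in>L - {k}. mu l * y l i) = (\<Sum>l\<in>L. lam l * y l i))"
proof -
  obtain c0 l0 where l0: "l0 \<in> L" "c0 l0 \<noteq> 0" and c0: "\<forall>i\<in>I. (\<Sum>l\<in>L. c0 l * y l i) = 0"
    using nontrivial_linear_relation[OF I L card, of y] by blast
  define c where "c l = sgn (c0 l0) * c0 l" for l
  have relation: "(\<Sum>l\<in>L. c l * y l i) = 0" if "i \<in> I" for i
    using c0 that by (simp add: c_def mult.assoc flip: sum_distrib_left)
  define P where "P = {l \<in> L. 0 < c l}"
  have "l0 \<in> P" using l0 by (simp add: P_def c_def sgn_if zero_less_mult_iff)
  moreover have "finite P" using L by (simp add: P_def)
  ultimately obtain k where k: "k \<in> P" and k_min: "\<And>l. l \<in> P \<Longrightarrow> lam k / c k \<le> lam l / c l"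
    using arg_min_if_finite[of P "\<lambda>l. lam l / c l"] by (metis empty_iff not_le)
  define t where "t = lam k / c k"
  have kL: "k \<in> L" "0 < c k" using k by (auto simp: P_def)
  then have t: "0 \<le> t" using lam by (simp add: t_def)
  define mu where "mu l = lam l - t * c l" for l
  have "0 \<le> mu l" if "l \<in> L" for l
  proof (cases "0 < c l")
    case True
    then show ?thesis using k_min[of l] that by (simp add: P_def mu_def t_def field_simps)
  next
    case False
    then show ?thesis using lam[OF that] mult_nonneg_nonpos[OF t, of "c l"] by (simp add: mu_def)
  qed
  moreover have "(\<Sum>l\<in>L - {k}. mu l * y l i) = (\<Sum>l\<in>L. lam l * y l i)" if "i \<in> I" for i
  proof -
    have "mu k = 0" using kL by (simp add: mu_def t_def)
    then have "(\<Sum>l\<in>L - {k}. mu l * y l i) = (\<Sum>l\<in>L. mu l * y l i)"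
      using L kL by (simp add: sum.remove[of L k])
    also have "\<dots> = (\<Sum>l\<in>L. lam l * y l i) - t * (\<Sum>l\<in>L. c l * y l i)"
      by (simp add: mu_def left_diff_distrib sum_subtractf sum_distrib_left mult.assoc)
    finally show ?thesis using relation[OF that] by simp
  qed
  ultimately show ?thesis using kL by blast
qed

lemma caratheodory_conic:
  fixes y :: "'l \<Rightarrow> 'i \<Rightarrow> real"
  assumes I: "finite I" and "finite L" "\<And>l. l \<in> L \<Longrightarrow> 0 \<le> lam l"
  shows "\<exists>L'\<subseteq>L. \<exists>mu. card L' \<le> card I \<and> (\<forall>l\<in>L'. 0 \<le> mu l) \<and>
    (\<forall>i\<in>I. (\<Sum>l\<in>L'. mu l * y l i) = (\<Sum>l\<in>L. lam l * y l i))"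
  using assms(2,3)
proof (induction L arbitrary: lam rule: finite_psubset_induct)
  case (psubset L)
  show ?case
  proof (cases "card L \<le> card I")
    case True
    then show ?thesis using psubset.prems
      by (intro exI[of _ L] conjI exI[of _ lam]) (auto simp only: subset_refl)
  next
    case False
    then have "card I < card L" by simp
    then have "\<exists>k\<in>L. \<exists>mu. (\<forall>l\<in>L - {k}. 0 \<le> mu l) \<and>
        (\<forall>i\<in>I. (\<Sum>l\<in>L - {k}. mu l * y l i) = (\<Sum>l\<in>L. lam l * y l i))"
      by (rule conic_combination_remove[OF I psubset.hyps]) (rule psubset.prems)
    then obtain k mu where k: "k \<in> L" and mu: "\<forall>l\<in>L - {k}. 0 \<le> mu l"
      and same_sums: "\<forall>i\<in>I. (\<Sum>l\<in>L - {k}. mu l * y l i) = (\<Sum>l\<in>L. lam l * y l i)"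
      by (elim bexE exE conjE)
    have "L - {k} \<subset> L" using k by blast
    then have "\<exists>L'\<subseteq>L - {k}. \<exists>nu. card L' \<le> card I \<and> (\<forall>l\<in>L'. 0 \<le> nu l) \<and>
        (\<forall>i\<in>I. (\<Sum>l\<in>L'. nu l * y l i) = (\<Sum>l\<in>L - {k}. mu l * y l i))"
      by (rule psubset.IH) (rule bspec[OF mu])
    then obtain L' nu where L': "L' \<subseteq> L - {k}" and "card L' \<le> card I" "\<forall>l\<in>L'. 0 \<le> nu l"
      and "\<forall>i\<in>I. (\<Sum>l\<in>L'. nu l * y l i) = (\<Sum>l\<in>L - {k}. mu l * y l i)" by (elim exE conjE)
    moreover from L' have "L' \<subseteq> L" by blast
    ultimately show ?thesis using same_sums by (intro exI[of _ L'] conjI exI[of _ nu]) simp_all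
  qed
qed

lemma linear_on_eqI_map_entry:
  assumes T: "linear_on d T" and S: "linear_on d S"
    and agree: "\<And>i. i \<in> quadruples d \<Longrightarrow> map_entry d T i = map_entry d S i" and x: "x \<in> carrier_mat d d"
  shows "T x = S x"
proof (rule linear_on_eqI[OF T S _ x])
  fix p q assume pq: "p < d" "q < d"
  have "T (munit d p q) $$ (r, s) = S (munit d p q) $$ (r, s)" if "r < d" "s < d" for r s
    using agree[of "(p, q, r, s)"] that pq by (simp add: map_entry_def)
  then show "T (munit d p q) = S (munit d p q)"
    using linear_on_carrier[OF T munit_carrier, of p q]
      linear_on_carrier[OF S munit_carrier, of p q]
    by (intro eq_matI) auto
qed

lemma map_entry_kraus_map:
  assumes "i \<in> quadruples d"
  shows "map_entry d (kraus_map d L lam A) i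
    = (\<Sum>l\<in>L. complex_of_real (lam l) * map_entry d (\<lambda>x. ctrans (A l) * x * A l) i)"
  using assms by (auto simp: map_entry_def kraus_map_def)

lemma conv_aut_caratheodory:
  assumes R: "R \<in> conv_aut d"
  shows "\<exists>L mu U. finite L \<and> card L \<le> 2 * d ^ 4 \<and> (\<forall>l\<in>L. 0 \<le> mu l \<and> unitary_mat d (U l)) \<and>
    (\<forall>x\<in>carrier_mat d d. R x = kraus_map d (L :: nat set) mu U x)"
proof -
  obtain N :: nat and lam U where lam: "\<And>l. l < N \<Longrightarrow> 0 \<le> lam l"
    and U: "\<And>l. l < N \<Longrightarrow> unitary_mat d (U l)"
    and R_eq: "R = kraus_map d {..<N} lam U"
    using R by (rule conv_autE) blast
  define I where "I = (UNIV :: bool set) \<times> quadruples d"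
  define z where "z l = map_entry d (\<lambda>x. ctrans (U l) * x * U l)" for l
  define y where "y l = (\<lambda>(b, i). if b then Re (z l i) else Im (z l i))" for l
  have I: "finite I" "card I = 2 * d ^ 4"
    by (simp_all add: I_def card_cartesian_product power4_eq_xxxx)
  obtain L mu where L: "L \<subseteq> {..<N}" "card L \<le> 2 * d ^ 4" and mu: "\<forall>l\<in>L. 0 \<le> mu l"
    and moments: "\<And>i. i \<in> I \<Longrightarrow> (\<Sum>l\<in>L. mu l * y l i) = (\<Sum>l<N. lam l * y l i)"
    using caratheodory_conic[OF I(1) finite_lessThan[of N], of lam y] lam unfolding I(2) by auto
  have carrier: "U l \<in> carrier_mat d d" if "l < N" for l
    using U[OF that] by (rule unitary_mat_carrier)
  have "R x = kraus_map d L mu U x" if "x \<in> carrier_mat d d" for x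
    unfolding R_eq
  proof (rule linear_on_eqI_map_entry[OF _ _ _ that])
    fix i assume i: "i \<in> quadruples d"
    have "(\<Sum>l\<in>L. complex_of_real (mu l) * z l i) = (\<Sum>l<N. complex_of_real (lam l) * z l i)"
      using moments[of "(True, i)"] moments[of "(False, i)"] i
      by (simp add: complex_eq_iff y_def I_def)
    then show "map_entry d (kraus_map d {..<N} lam U) i = map_entry d (kraus_map d L mu U) i"
      unfolding map_entry_kraus_map[OF i] z_def by simp
  qed (use carrier L in \<open>auto intro!: linear_on_kraus_map\<close>)
  moreover have "finite L" using L(1) finite_subset by blast
  ultimately show ?thesis using L mu U by blast
qed

text \<open>The weights sum to 1 because R is unital.\<close>

lemma conv_aut_bounded_terms:
  assumes R: "R \<in> conv_aut d" and d: "1 \<le> d"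
  shows "\<exists>mu U. (\<forall>l\<in>{..<2 * d ^ 4}. 0 \<le> mu l \<and> unitary_mat d (U l)) \<and> (\<Sum>l<2 * d ^ 4. mu l) = 1 \<and>
    (\<forall>x\<in>carrier_mat d d. R x = kraus_map d {..<2 * d ^ 4} mu U x)"
proof -
  obtain L :: "nat set" and mu U where L: "finite L" "card L \<le> 2 * d ^ 4"
    and mu: "\<And>l. l \<in> L \<Longrightarrow> 0 \<le> mu l" and U: "\<And>l. l \<in> L \<Longrightarrow> unitary_mat d (U l)"
    and R_eq: "\<And>x. x \<in> carrier_mat d d \<Longrightarrow> R x = kraus_map d L mu U x"
    using conv_aut_caratheodory[OF R] by blast
  obtain h where h: "bij_betw h {..<card L} L"
    using ex_bij_betw_nat_finite[OF L(1)] unfolding atLeast0LessThan by blast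
  have hL: "h l \<in> L" if "l < card L" for l using h that by (auto simp: bij_betw_def)
  define mu' where "mu' l = (if l < card L then mu (h l) else 0)" for l
  define U' where "U' l = (if l < card L then U (h l) else 1\<^sub>m d)" for l
  have mu': "0 \<le> mu' l" for l using mu hL by (simp add: mu'_def)
  have U': "unitary_mat d (U' l)" for l using U hL unitary_mat_one by (simp add: U'_def)
  have pad: "(\<Sum>l<2 * d ^ 4. complex_of_real (mu' l) * f (U' l))
      = (\<Sum>l\<in>L. complex_of_real (mu l) * f (U l))" for f
  proof -
    have "(\<Sum>l<2 * d ^ 4. complex_of_real (mu' l) * f (U' l))
        = (\<Sum>l<card L. complex_of_real (mu' l) * f (U' l))"
      using L(2) by (intro sum.mono_neutral_right) (auto simp: mu'_def)
    also have "\<dots> = (\<Sum>l<card L. complex_of_real (mu (h l)) * f (U (h l)))"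
      by (intro sum.cong refl) (auto simp: mu'_def U'_def)
    finally show ?thesis
      by (simp add: sum.reindex_bij_betw[OF h, of "\<lambda>l. complex_of_real (mu l) * f (U l)"])
  qed
  have R_eq': "R x = kraus_map d {..<2 * d ^ 4} mu' U' x" if "x \<in> carrier_mat d d" for x
    unfolding R_eq[OF that] kraus_map_altdef
    by (simp add: pad[of "\<lambda>V. (ctrans V * x * V) $$ _"] del: assoc_mult_mat)
  have "complex_of_real (\<Sum>l<2 * d ^ 4. mu' l) \<cdot>\<^sub>m 1\<^sub>m d = 1\<^sub>m d"
    using R_eq'[OF one_carrier_mat] conv_aut_one[OF R] U' by (simp add: kraus_map_unitary_mat_one)
  then have "(complex_of_real (\<Sum>l<2 * d ^ 4. mu' l) \<cdot>\<^sub>m 1\<^sub>m d) $$ (0, 0) = 1\<^sub>m d $$ (0, 0)" by simp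
  then have "(\<Sum>l<2 * d ^ 4. mu' l) = 1" using d by (simp flip: of_real_sum)
  then show ?thesis using mu' U' R_eq' by blast
qed

lemma mat_LIMSEQ_kraus_map:
  assumes lam: "\<And>l. l \<in> L \<Longrightarrow> (\<lambda>k. mu k l) \<longlonglongrightarrow> lam l"
    and lim: "\<And>l. l \<in> L \<Longrightarrow> mat_LIMSEQ d (\<lambda>k. U k l) (V l)"
    and U: "\<And>k l. l \<in> L \<Longrightarrow> U k l \<in> carrier_mat d d" and V: "\<And>l. l \<in> L \<Longrightarrow> V l \<in> carrier_mat d d"
    and x: "x \<in> carrier_mat d d"
  shows "mat_LIMSEQ d (\<lambda>k. kraus_map d L (mu k) (U k) x) (kraus_map d L lam V x)"
proof -
  have "mat_LIMSEQ d (\<lambda>k. ctrans (U k l) * x * U k l) (ctrans (V l) * x * V l)" if l: "l \<in> L" for l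
    using U[OF l] V[OF l]
    by (intro mat_LIMSEQ_mult mat_LIMSEQ_ctrans mat_LIMSEQ_const lim[OF l]
        mult_carrier_mat[of _ d d _ d] x) auto
  then show ?thesis
    unfolding mat_LIMSEQ_def kraus_map_def using lam
    by (auto intro!: tendsto_sum tendsto_mult tendsto_of_real simp del: assoc_mult_mat)
qed

lemma conv_aut_closed:
  assumes R: "\<And>k. R k \<in> conv_aut d" and d: "1 \<le> d"
    and lim: "\<And>x. x \<in> carrier_mat d d \<Longrightarrow> mat_LIMSEQ d (\<lambda>k. R k x) (T x)"
    and T: "\<And>x. x \<in> carrier_mat d d \<Longrightarrow> T x \<in> carrier_mat d d"
  shows "in_conv_aut d T"
proof -
  define L where "L = {..<2 * d ^ 4}"
  have "\<forall>k. \<exists>mu U. (\<forall>l\<in>L. 0 \<le> mu l \<and> unitary_mat d (U l)) \<and> (\<Sum>l\<in>L. mu l) = 1 \<and>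
      (\<forall>x\<in>carrier_mat d d. R k x = kraus_map d L mu U x)"
    unfolding L_def using conv_aut_bounded_terms[OF R d] by blast
  then obtain mu U where mu: "\<And>k l. l \<in> L \<Longrightarrow> 0 \<le> mu k l" "\<And>k. (\<Sum>l\<in>L. mu k l) = 1"
    and U: "\<And>k l. l \<in> L \<Longrightarrow> unitary_mat d (U k l)"
    and R_eq: "\<And>k x. x \<in> carrier_mat d d \<Longrightarrow> R k x = kraus_map d L (mu k) (U k) x"
    by metis
  have L: "finite L" by (simp add: L_def)
  obtain r V where r: "strict_mono r" and V: "\<And>l. l \<in> L \<Longrightarrow> unitary_mat d (V l)"
    and U_lim: "\<And>l. l \<in> L \<Longrightarrow> mat_LIMSEQ d (\<lambda>k. U (r k) l) (V l)"
    using unitary_family_convergent_subseq[OF L, of d U] U by blast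
  have "norm (mu (r k) l) \<le> 1" if "l \<in> L" for k l
    using member_le_sum[OF that, of "mu (r k)"] mu L that by auto
  then have "bounded (range (\<lambda>k. mu (r k) l))" if "l \<in> L" for l
    using that by (intro boundedI) blast
  then obtain q lam where q: "strict_mono q" and mu_lim: "\<And>l. l \<in> L \<Longrightarrow> (\<lambda>k. mu (r (q k)) l) \<longlonglongrightarrow> lam l"
    using bounded_family_convergent_subseq[OF L, of "\<lambda>k. mu (r k)"] by blast
  have "(\<lambda>k. \<Sum>l\<in>L. mu (r (q k)) l) \<longlonglongrightarrow> (\<Sum>l\<in>L. lam l)" by (intro tendsto_sum mu_lim)
  then have "(\<Sum>l\<in>L. lam l) = 1" by (simp add: mu(2) LIMSEQ_const_iff)
  moreover have "0 \<le> lam l" if "l \<in> L" for l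
    using LIMSEQ_le_const[OF mu_lim[OF that], of 0] mu(1)[OF that] by blast
  ultimately have "kraus_map d L lam V \<in> conv_aut d" using L V by (intro kraus_map_in_conv_aut)
  moreover have "T x = kraus_map d L lam V x" if x: "x \<in> carrier_mat d d" for x
  proof (rule mat_LIMSEQ_unique[OF _ _ T[OF x] kraus_map_carrier])
    show "mat_LIMSEQ d (\<lambda>k. R (r (q k)) x) (T x)"
      by (rule mat_LIMSEQ_subseq[OF mat_LIMSEQ_subseq[OF lim[OF x] r] q])
    show "mat_LIMSEQ d (\<lambda>k. R (r (q k)) x) (kraus_map d L lam V x)"
      unfolding R_eq[OF x]
      by (intro mat_LIMSEQ_kraus_map mu_lim mat_LIMSEQ_subseq[OF U_lim q] x unitary_mat_carrier U V)
  qed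
  ultimately show ?thesis unfolding in_conv_aut_def by blast
qed

section \<open>Mixtures of contractions\<close>

lemma contraction_kraus_map_dominated:
  assumes L: "finite L" and lam: "\<And>l. l \<in> L \<Longrightarrow> 0 \<le> lam l" "(\<Sum>l\<in>L. lam l) = 1"
    and A: "\<And>l. l \<in> L \<Longrightarrow> A l \<in> carrier_mat n n" "\<And>l. l \<in> L \<Longrightarrow> opnorm (A l) \<le> 1"
  shows "\<exists>R\<in>conv_aut n. \<exists>B. (\<forall>l\<in>L. B l \<in> carrier_mat n n) \<and>
    (\<forall>x\<in>carrier_mat n n. R x = kraus_map n L lam A x + kraus_map n L lam B x)"
proof -
  have "\<forall>l\<in>L. \<exists>B\<in>carrier_mat n n. unitary_mat n (A l + \<i> \<cdot>\<^sub>m B) \<and> unitary_mat n (A l + (- \<i>) \<cdot>\<^sub>m B)"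
    using contraction_eq_mean_unitary A by blast
  then obtain B where B: "\<And>l. l \<in> L \<Longrightarrow> B l \<in> carrier_mat n n"
    and unitary: "\<And>l. l \<in> L \<Longrightarrow> unitary_mat n (A l + \<i> \<cdot>\<^sub>m B l)"
      "\<And>l. l \<in> L \<Longrightarrow> unitary_mat n (A l + (- \<i>) \<cdot>\<^sub>m B l)"
    by metis
  define W where "W = (\<lambda>(l, b). A l + (if b then \<i> else - \<i>) \<cdot>\<^sub>m B l)"
  define R where "R = kraus_map n (L \<times> UNIV) (\<lambda>(l, b). lam l / 2) W"
  have "(\<Sum>(l, b)\<in>L \<times> (UNIV :: bool set). lam l / 2) = 1"
    using lam(2) by (simp add: UNIV_bool flip: sum.cartesian_product)
  then have "R \<in> conv_aut n"
    unfolding R_def using L lam(1) unitary by (intro kraus_map_in_conv_aut) (auto simp: W_def)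
  moreover have "R x = kraus_map n L lam A x + kraus_map n L lam B x" if x: "x \<in> carrier_mat n n"
    for x
  proof (rule eq_mat_dimI)
    fix i j assume ij: "i < n" "j < n"
    let ?c = "\<lambda>C. (ctrans C * x * C) $$ (i, j)"
    have "R x $$ (i, j) = (\<Sum>l\<in>L. lam l / 2 * (?c (A l + \<i> \<cdot>\<^sub>m B l) + ?c (A l + (- \<i>) \<cdot>\<^sub>m B l)))"
      using ij by (simp add: R_def W_def kraus_map_def sum.cartesian_product' UNIV_bool
          algebra_simps del: assoc_mult_mat)
    also have "\<dots> = (\<Sum>l\<in>L. lam l * ?c (A l) + lam l * ?c (B l))"
      by (intro sum.cong refl) (simp add: parallelogram_conjugation[OF A(1) B x ij] distrib_left
          del: assoc_mult_mat)
    finally show "R x $$ (i, j) = (kraus_map n L lam A x + kraus_map n L lam B x) $$ (i, j)"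
      using ij by (simp add: kraus_map_def sum.distrib del: assoc_mult_mat)
  qed (simp_all add: R_def)
  ultimately show ?thesis using B by blast
qed

lemma cb_norm_contraction_mixture_le:
  assumes T: "linear_on n T" "T (1\<^sub>m n) = 1\<^sub>m n"
    and L: "finite L" and lam: "\<And>l. l \<in> L \<Longrightarrow> 0 \<le> lam l" "(\<Sum>l\<in>L. lam l) = 1"
    and A: "\<And>l. l \<in> L \<Longrightarrow> A l \<in> carrier_mat n n" "\<And>l. l \<in> L \<Longrightarrow> opnorm (A l) \<le> 1"
  shows "\<exists>R\<in>conv_aut n. cb_norm n (\<lambda>x. T x - R x) \<le> 2 * cb_norm n (\<lambda>x. T x - kraus_map n L lam A x)"
proof -
  let ?K = "kraus_map n L lam A"
  let ?d = "cb_norm n (\<lambda>x. T x - ?K x)"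
  have "\<exists>R\<in>conv_aut n. \<exists>B. (\<forall>l\<in>L. B l \<in> carrier_mat n n) \<and>
      (\<forall>x\<in>carrier_mat n n. R x = ?K x + kraus_map n L lam B x)"
    by (rule contraction_kraus_map_dominated[OF L lam]) (assumption | rule A)+
  then obtain R B where R: "R \<in> conv_aut n" and B: "\<And>l. l \<in> L \<Longrightarrow> B l \<in> carrier_mat n n"
    and R_eq: "\<And>x. x \<in> carrier_mat n n \<Longrightarrow> R x = ?K x + kraus_map n L lam B x" by blast
  let ?\<Phi> = "kraus_map n L lam B"
  have linear: "linear_on n (\<lambda>x. T x - ?K x)" "linear_on n ?\<Phi>"
    using A(1) B by (auto intro!: linear_on_diff linear_on_kraus_map T)
  have "?\<Phi> (1\<^sub>m n) = ?K (1\<^sub>m n) + ?\<Phi> (1\<^sub>m n) - ?K (1\<^sub>m n)"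
    by (rule eq_matI) auto
  also have "\<dots> = T (1\<^sub>m n) - ?K (1\<^sub>m n)"
    using R_eq[OF one_carrier_mat] conv_aut_one[OF R] T(2) by simp
  finally have "?\<Phi> (1\<^sub>m n) = T (1\<^sub>m n) - ?K (1\<^sub>m n)" .
  moreover have "opnorm (1\<^sub>m n) \<le> 1" by (rule opnorm_unitary_mat_le[OF unitary_mat_one])
  ultimately have "opnorm (?\<Phi> (1\<^sub>m n)) \<le> ?d"
    using opnorm_apply_le_cb_norm[OF linear(1) one_carrier_mat] by simp
  moreover have "cb_norm n ?\<Phi> \<le> opnorm (?\<Phi> (1\<^sub>m n))" by (rule cb_norm_kraus_map_le[OF lam(1) B])
  moreover have "cb_norm n (\<lambda>x. T x - R x) = cb_norm n (\<lambda>x. T x - ?K x - ?\<Phi> x)"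
  proof (rule cb_norm_cong)
    fix x :: "complex mat" assume x: "x \<in> carrier_mat n n"
    show "T x - R x = T x - ?K x - ?\<Phi> x"
      unfolding R_eq[OF x] using linear_on_carrier[OF T(1) x] by (intro eq_matI) auto
  qed
  ultimately have "cb_norm n (\<lambda>x. T x - R x) \<le> 2 * ?d"
    using cb_norm_diff_le[OF linear] by simp
  then show ?thesis using R by blast
qed

lemma cb_norm_diff_kraus_map_compression_le:
  assumes F: "linear_on N F" and V: "V \<in> carrier_mat N n" "ctrans V * V = 1\<^sub>m n"
    and U: "\<And>l. l \<in> L \<Longrightarrow> U l \<in> carrier_mat N N"
  shows "cb_norm n (\<lambda>x. ctrans V * F (V * x * ctrans V) * V
      - kraus_map n L lam (\<lambda>l. ctrans V * U l * V) x)
    \<le> cb_norm N (\<lambda>x. F x - kraus_map N L lam U x)"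
proof -
  let ?R = "kraus_map N L lam U"
  have R: "linear_on N ?R" using U by (rule linear_on_kraus_map)
  have Vc: "ctrans V \<in> carrier_mat n N" using V by simp
  have "cb_norm n (\<lambda>x. ctrans V * F (V * x * ctrans V) * V
      - kraus_map n L lam (\<lambda>l. ctrans V * U l * V) x)
      = cb_norm n (\<lambda>x. ctrans V * (F (V * x * ctrans V) - ?R (V * x * ctrans V)) * V)"
  proof (rule cb_norm_cong)
    fix x :: "complex mat" assume x: "x \<in> carrier_mat n n"
    have VxV: "V * x * ctrans V \<in> carrier_mat N N" by (rule mult_mult_carrier_mat[OF V(1) x Vc])
    have "ctrans V * (F (V * x * ctrans V) - ?R (V * x * ctrans V)) * V
        = ctrans V * F (V * x * ctrans V) * V - ctrans V * ?R (V * x * ctrans V) * V"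
      using V(1) Vc linear_on_carrier[OF F VxV]
      by (simp add: mult_minus_distrib_mat[of _ n N _ N] minus_mult_distrib_mat[of _ n N _ V n]
          del: assoc_mult_mat)
    also have "ctrans V * ?R (V * x * ctrans V) * V = kraus_map n L lam (\<lambda>l. ctrans V * U l * V) x"
      using U V(1) x by (rule kraus_map_compression)
    finally show "ctrans V * F (V * x * ctrans V) * V - kraus_map n L lam (\<lambda>l. ctrans V * U l * V) x
        = ctrans V * (F (V * x * ctrans V) - ?R (V * x * ctrans V)) * V" ..
  qed
  also have "\<dots> \<le> cb_norm N (\<lambda>x. F x - ?R x)"
    by (rule cb_norm_compression_le[OF linear_on_diff[OF F R] V])
  finally show ?thesis .
qed

lemma conv_aut_near_compression:
  assumes F: "linear_on N F" and T: "linear_on n T" "T (1\<^sub>m n) = 1\<^sub>m n"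
    and V: "V \<in> carrier_mat N n" "ctrans V * V = 1\<^sub>m n"
    and compression: "\<And>x. x \<in> carrier_mat n n \<Longrightarrow> ctrans V * F (V * x * ctrans V) * V = T x"
    and R: "R \<in> conv_aut N"
  shows "\<exists>R'\<in>conv_aut n. cb_norm n (\<lambda>x. T x - R' x) \<le> 2 * cb_norm N (\<lambda>x. F x - R x)"
proof -
  obtain M :: nat and lam U where lam: "\<And>l. l < M \<Longrightarrow> 0 \<le> lam l" "(\<Sum>l<M. lam l) = 1"
    and U: "\<And>l. l < M \<Longrightarrow> unitary_mat N (U l)" and R_eq: "R = kraus_map N {..<M} lam U"
    using R by (rule conv_autE) blast
  define A where "A l = ctrans V * U l * V" for l
  have A: "A l \<in> carrier_mat n n" "opnorm (A l) \<le> 1" if "l < M" for l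
  proof -
    note Ul = unitary_mat_carrier[OF U[OF that]]
    show "A l \<in> carrier_mat n n" unfolding A_def using V(1) Ul by (intro mult_mult_carrier_mat) auto
    show "opnorm (A l) \<le> 1"
      using opnorm_contraction_conjugation_le[OF V(1) opnorm_isometry_le[OF V] Ul]
        opnorm_unitary_mat_le[OF U[OF that]] unfolding A_def by linarith
  qed
  have "cb_norm n (\<lambda>x. T x - kraus_map n {..<M} lam A x)
      = cb_norm n (\<lambda>x. ctrans V * F (V * x * ctrans V) * V - kraus_map n {..<M} lam A x)"
    by (rule cb_norm_cong) (simp only: compression)
  also have "\<dots> \<le> cb_norm N (\<lambda>x. F x - R x)"
    unfolding R_eq A_def using U unitary_mat_carrier
    by (intro cb_norm_diff_kraus_map_compression_le F V) auto
  finally show ?thesis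
    using cb_norm_contraction_mixture_le[OF T finite_lessThan, of M lam A] lam A by force
qed

section \<open>Distance to the automorphisms\<close>

lemma d_cb_le_cb_norm:
  assumes T: "linear_on d T" and R: "R \<in> conv_aut d"
  shows "d_cb d T (conv_aut d) \<le> cb_norm d (\<lambda>x. T x - R x)"
  unfolding d_cb_def using R
  by (intro cInf_lower bdd_belowI[of _ 0])
    (auto intro!: cb_norm_nonneg linear_on_diff[OF T linear_on_conv_aut])

lemma d_cb_geI:
  assumes "\<And>R. R \<in> conv_aut d \<Longrightarrow> c \<le> cb_norm d (\<lambda>x. T x - R x)"
  shows "c \<le> d_cb d T (conv_aut d)"
  unfolding d_cb_def using conv_aut_nonempty assms by (intro cInf_greatest) auto

lemma d_cb_nonneg: "linear_on d T \<Longrightarrow> 0 \<le> d_cb d T (conv_aut d)"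
  by (rule d_cb_geI) (rule cb_norm_nonneg[OF linear_on_diff[OF _ linear_on_conv_aut]])

lemma d_cb_compression_ge:
  assumes F: "linear_on N F" and T: "linear_on n T" "T (1\<^sub>m n) = 1\<^sub>m n"
    and V: "V \<in> carrier_mat N n" "ctrans V * V = 1\<^sub>m n"
    and compression: "\<And>x. x \<in> carrier_mat n n \<Longrightarrow> ctrans V * F (V * x * ctrans V) * V = T x"
  shows "1/2 * d_cb n T (conv_aut n) \<le> d_cb N F (conv_aut N)"
proof (rule d_cb_geI)
  fix R assume "R \<in> conv_aut N"
  then obtain R' where "R' \<in> conv_aut n"
    "cb_norm n (\<lambda>x. T x - R' x) \<le> 2 * cb_norm N (\<lambda>x. F x - R x)"
    using conv_aut_near_compression[OF F T V compression] by blast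
  then show "1/2 * d_cb n T (conv_aut n) \<le> cb_norm N (\<lambda>x. F x - R x)"
    using d_cb_le_cb_norm[OF T(1)] by fastforce
qed

definition first_basis_column :: "nat \<Rightarrow> complex mat" where
  "first_basis_column k = mat k 1 (\<lambda>(i, _). if i = 0 then 1 else 0)"

lemma first_basis_column_carrier: "first_basis_column k \<in> carrier_mat k 1"
  by (simp add: first_basis_column_def)

lemma first_basis_column_mult_ctrans:
  "first_basis_column k * 1\<^sub>m 1 * ctrans (first_basis_column k) = munit k 0 0"
  by (rule eq_matI) (auto simp: first_basis_column_def scalar_prod_def)

lemma ctrans_first_basis_column_mult_mult:
  assumes y: "y \<in> carrier_mat k k" and k: "1 \<le> k"
  shows "ctrans (first_basis_column k) * y * first_basis_column k = y $$ (0, 0) \<cdot>\<^sub>m 1\<^sub>m 1"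
proof (rule eq_mat_dimI)
  fix i j :: nat assume ij: "i < 1" "j < 1"
  have "(ctrans (first_basis_column k) * y * first_basis_column k) $$ (0, 0)
      = (\<Sum>p<k. \<Sum>q<k. ctrans (first_basis_column k) $$ (0, p) * y $$ (p, q)
          * first_basis_column k $$ (q, 0))"
    by (rule index_mult_mult_mat_sum[where r = 1, OF _ y first_basis_column_carrier])
      (simp_all add: first_basis_column_def)
  also have "\<dots> = (\<Sum>p<k. \<Sum>q<k. if q = 0 then if p = 0 then y $$ (0, 0) else 0 else 0)"
    by (intro sum.cong refl) (auto simp: first_basis_column_def)
  also have "\<dots> = y $$ (0, 0)" using k by simp
  finally show "(ctrans (first_basis_column k) * y * first_basis_column k) $$ (i, j)
      = (y $$ (0, 0) \<cdot>\<^sub>m 1\<^sub>m 1) $$ (i, j)"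
    using ij by simp
qed (auto simp: first_basis_column_def)

lemma d_cb_tensor_map_ge:
  assumes T: "linear_on n T" "T (1\<^sub>m n) = 1\<^sub>m n" and S: "linear_on k S"
    and k: "1 \<le> k" and S_corner: "S (munit k 0 0) $$ (0, 0) = 1"
  shows "1/2 * d_cb n T (conv_aut n) \<le> d_cb (n * k) (tensor_map n k T S) (conv_aut (n * k))"
proof -
  let ?e = "first_basis_column k"
  define V where "V = kron (1\<^sub>m n) ?e"
  have column: "?e \<in> carrier_mat k 1" and row: "ctrans ?e \<in> carrier_mat 1 k"
    by (simp_all add: first_basis_column_def)
  have V: "V \<in> carrier_mat (n * k) n"
    using kron_carrier[OF one_carrier_mat column, of n] by (simp add: V_def)
  have compress: "ctrans V * kron x y * V = y $$ (0, 0) \<cdot>\<^sub>m x"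
    if x: "x \<in> carrier_mat n n" and y: "y \<in> carrier_mat k k" for x y
  proof -
    have "ctrans V * kron x y * V = kron x (ctrans ?e * y * ?e)"
      unfolding V_def ctrans_kron ctrans_one by (rule kron_one_mult_kron_mult[OF row column x y])
    also have "\<dots> = y $$ (0, 0) \<cdot>\<^sub>m x"
      unfolding ctrans_first_basis_column_mult_mult[OF y k] by (rule eq_matI) (auto simp: kron_def)
    finally show ?thesis .
  qed
  have "ctrans V * V = ctrans V * kron (1\<^sub>m n) (1\<^sub>m k) * V"
    using V by (simp add: kron_one)
  then have isometry: "ctrans V * V = 1\<^sub>m n"
    using k by (simp only: compress[OF one_carrier_mat one_carrier_mat]) (simp add: one_smult_mat)
  have "ctrans V * tensor_map n k T S (V * x * ctrans V) * V = T x" if x: "x \<in> carrier_mat n n"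
    for x
  proof -
    have "V * kron x (1\<^sub>m 1) * ctrans V = kron x (munit k 0 0)"
      unfolding V_def ctrans_kron ctrans_one kron_one_mult_kron_mult[OF column row x one_carrier_mat]
        first_basis_column_mult_ctrans ..
    then have "tensor_map n k T S (V * x * ctrans V) = kron (T x) (S (munit k 0 0))"
      by (simp add: tensor_map_kron[OF T(1) S x munit_carrier] del: assoc_mult_mat)
    then show ?thesis
      using compress[OF linear_on_carrier[OF T(1) x] linear_on_carrier[OF S munit_carrier]]
      by (simp add: S_corner one_smult_mat)
  qed
  then show ?thesis by (rule d_cb_compression_ge[OF linear_on_tensor_map T V isometry])
qed

lemma linear_on_tensor_pow: "linear_on n T \<Longrightarrow> linear_on (n ^ k) (tensor_pow n k T)"
  by (cases k) (simp_all add: linear_on_id linear_on_tensor_map)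

lemma tensor_pow_corner:
  assumes n: "1 \<le> n" and T: "linear_on n T" and T_corner: "T (munit n 0 0) $$ (0, 0) = 1"
  shows "tensor_pow n k T (munit (n ^ k) 0 0) $$ (0, 0) = 1"
proof (induction k)
  case (Suc k)
  have nk: "0 < n ^ k" using n by simp
  have "tensor_map n (n ^ k) T (tensor_pow n k T) (munit (n * n ^ k) 0 0)
      = kron (T (munit n 0 0)) (tensor_pow n k T (munit (n ^ k) 0 0))"
    using munit_eq_kron[of 0 n "n ^ k" 0] n nk
      tensor_map_kron[OF T linear_on_tensor_pow[OF T] munit_carrier munit_carrier] by simp
  also have "\<dots> $$ (0, 0) = 1"
    using index_kron_mult_add[OF linear_on_carrier[OF T munit_carrier]
        linear_on_carrier[OF linear_on_tensor_pow[OF T] munit_carrier],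
        of 0 0 0 k 0 0 0 0] n nk T_corner Suc.IH by simp
  finally show ?case by simp
qed simp

lemma asymptotic_QBP_imp_d_cb_eq_0:
  assumes n: "1 \<le> n" and T: "linear_on n T" "T (1\<^sub>m n) = 1\<^sub>m n"
    and T_corner: "T (munit n 0 0) $$ (0, 0) = 1"
    and QBP: "asymptotic_QBP n T"
  shows "d_cb n T (conv_aut n) = 0"
proof -
  have "1/2 * d_cb n T (conv_aut n)
      \<le> d_cb (n ^ Suc k) (tensor_pow n (Suc k) T) (conv_aut (n ^ Suc k))" for k
    using d_cb_tensor_map_ge[OF T linear_on_tensor_pow[OF T(1)] _
        tensor_pow_corner[OF n T(1) T_corner]] n
    by simp
  moreover have "(\<lambda>k. d_cb (n ^ Suc k) (tensor_pow n (Suc k) T) (conv_aut (n ^ Suc k))) \<longlonglongrightarrow> 0"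
    using QBP unfolding asymptotic_QBP_def by (rule LIMSEQ_Suc)
  ultimately have "1/2 * d_cb n T (conv_aut n) \<le> 0"
    by (intro LIMSEQ_le_const) auto
  then show ?thesis using d_cb_nonneg[OF T(1)] by simp
qed

lemma mat_LIMSEQ_if_munit:
  assumes R: "\<And>k. linear_on d (R k)" and T: "linear_on d T"
    and lim: "\<And>p q. p < d \<Longrightarrow> q < d \<Longrightarrow> mat_LIMSEQ d (\<lambda>k. R k (munit d p q)) (T (munit d p q))"
    and x: "x \<in> carrier_mat d d"
  shows "mat_LIMSEQ d (\<lambda>k. R k x) (T x)"
  unfolding mat_LIMSEQ_def
proof (intro allI impI)
  fix i j assume ij: "i < d" "j < d"
  show "(\<lambda>k. R k x $$ (i, j)) \<longlonglongrightarrow> T x $$ (i, j)"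
    unfolding linear_on_index[OF R x ij] linear_on_index[OF T x ij]
    using lim ij by (intro tendsto_sum tendsto_mult tendsto_const) (auto simp: mat_LIMSEQ_def)
qed

lemma mat_LIMSEQ_if_cb_norm_tendsto_0:
  assumes R: "\<And>k. linear_on d (R k)" and T: "linear_on d T"
    and lim: "(\<lambda>k. cb_norm d (\<lambda>x. T x - R k x)) \<longlonglongrightarrow> 0" and x: "x \<in> carrier_mat d d"
  shows "mat_LIMSEQ d (\<lambda>k. R k x) (T x)"
proof (rule mat_LIMSEQ_if_munit[OF R T _ x], unfold mat_LIMSEQ_def, intro allI impI)
  fix p q i j assume pq: "p < d" "q < d" and ij: "i < d" "j < d"
  let ?E = "munit d p q"
  have "cmod (T ?E $$ (i, j) - R k ?E $$ (i, j)) \<le> cb_norm d (\<lambda>x. T x - R k x)" for k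
  proof -
    have D: "linear_on d (\<lambda>x. T x - R k x)" by (rule linear_on_diff[OF T R])
    have "cmod (T ?E $$ (i, j) - R k ?E $$ (i, j)) = cmod ((T ?E - R k ?E) $$ (i, j))"
      using ij linear_on_carrier[OF R munit_carrier, of k p q] by simp
    also have "\<dots> \<le> opnorm (T ?E - R k ?E)"
      by (rule cmod_index_le_opnorm[OF linear_on_carrier[OF D munit_carrier] ij])
    also have "\<dots> \<le> cb_norm d (\<lambda>x. T x - R k x)"
      by (rule opnorm_apply_le_cb_norm[OF D munit_carrier opnorm_munit_le[OF pq(2)]])
    finally show ?thesis .
  qed
  then have "(\<lambda>k. T ?E $$ (i, j) - R k ?E $$ (i, j)) \<longlonglongrightarrow> 0"
    by (intro tendsto_0_le[OF lim, of _ 1] always_eventually allI)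
      (simp add: order_trans[OF _ abs_ge_self])
  from tendsto_diff[OF tendsto_const[of "T ?E $$ (i, j)"] this]
  show "(\<lambda>k. R k ?E $$ (i, j)) \<longlonglongrightarrow> T ?E $$ (i, j)" by simp
qed

lemma in_conv_aut_if_d_cb_eq_0:
  assumes n: "1 \<le> n" and T: "linear_on n T" and d_cb_0: "d_cb n T (conv_aut n) = 0"
  shows "in_conv_aut n T"
proof -
  have "\<exists>R\<in>conv_aut n. cb_norm n (\<lambda>x. T x - R x) < 1 / real (Suc k)" for k
  proof -
    have "d_cb n T (conv_aut n) < 1 / real (Suc k)" by (simp add: d_cb_0)
    from cInf_lessD[OF _ this[unfolded d_cb_def]] show ?thesis using conv_aut_nonempty by auto
  qed
  then obtain R where R: "\<And>k. R k \<in> conv_aut n"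
    and R_near: "\<And>k. cb_norm n (\<lambda>x. T x - R k x) < 1 / real (Suc k)"
    by metis
  have "(\<lambda>k. cb_norm n (\<lambda>x. T x - R k x)) \<longlonglongrightarrow> 0"
  proof (rule tendsto_0_le[OF LIMSEQ_Suc[OF lim_1_over_n]])
    show "\<forall>\<^sub>F k in sequentially. norm (cb_norm n (\<lambda>x. T x - R k x)) \<le> norm (1 / real (Suc k)) * 1"
      using R_near cb_norm_nonneg[OF linear_on_diff[OF T linear_on_conv_aut[OF R]]]
      by (intro always_eventually allI) (simp add: less_imp_le)
  qed
  then have "mat_LIMSEQ n (\<lambda>k. R k x) (T x)" if "x \<in> carrier_mat n n" for x
    by (rule mat_LIMSEQ_if_cb_norm_tendsto_0[OF linear_on_conv_aut[OF R] T _ that])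
  then show ?thesis by (rule conv_aut_closed[OF R n _ linear_on_carrier[OF T]])
qed

lemma UCPT_schur_linear_on: "UCPT_schur d T \<Longrightarrow> linear_on d T"
  by (simp add: UCPT_schur_def UCPT_def)

lemma UCPT_schur_one: "UCPT_schur d T \<Longrightarrow> T (1\<^sub>m d) = 1\<^sub>m d"
  by (simp add: UCPT_schur_def UCPT_def)

lemma UCPT_schur_munit_diag:
  assumes T: "UCPT_schur d T" and i: "i < d"
  shows "T (munit d i i) $$ (i, i) = 1"
proof -
  obtain b where b: "\<And>x. x \<in> carrier_mat d d \<Longrightarrow> T x = mat d d (\<lambda>(i, j). b $$ (i, j) * x $$ (i, j))"
    using T unfolding UCPT_schur_def by blast
  have "T (1\<^sub>m d) $$ (i, i) = 1" using i by (simp add: UCPT_schur_one[OF T])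
  then show ?thesis using i by (simp add: b)
qed

theorem theorem2p4:
  fixes n k :: nat and T S :: "complex mat \<Rightarrow> complex mat"
  assumes "n \<ge> 1" and "k \<ge> 1"
    and "UCPT_schur n T" and "UCPT_schur k S"
  shows "d_cb (n*k) (tensor_map n k T S) (conv_aut (n*k)) \<ge> 1/2 * d_cb n T (conv_aut n)
         \<and> (\<not> in_conv_aut n T \<longrightarrow> \<not> asymptotic_QBP n T)"
proof -
  note T = UCPT_schur_linear_on[OF assms(3)] UCPT_schur_one[OF assms(3)]
  have T_corner: "T (munit n 0 0) $$ (0, 0) = 1" and S_corner: "S (munit k 0 0) $$ (0, 0) = 1"
    using assms by (simp_all add: UCPT_schur_munit_diag)
  have "1/2 * d_cb n T (conv_aut n) \<le> d_cb (n * k) (tensor_map n k T S) (conv_aut (n * k))"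
    by (rule d_cb_tensor_map_ge[OF T UCPT_schur_linear_on[OF assms(4)] assms(2) S_corner])
  moreover have "in_conv_aut n T" if "asymptotic_QBP n T"
    using asymptotic_QBP_imp_d_cb_eq_0[OF assms(1) T T_corner that]
    by (rule in_conv_aut_if_d_cb_eq_0[OF assms(1) T(1)])
  ultimately show ?thesis by blast
qed

end
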